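(* Let $m\ge1$ and $A_m=\{0,1,\dots,m\}$. The elements $\mathbf{R}_w=\sum_{\mathrm{GD}(\sigma)=w}\mathbf{F}_\sigma$, for $w$ a word on $A_m$, generate a Hopf subalgebra ${}^m\mathbf{NCSF}$ of ${}^m\mathbf{FQSym}$. Their product is given by the formula $$\mathbf{R}_w\mathbf{R}_{w'}=\sum_{k\in A_m}\mathbf{R}_{w\cdot k\cdot w'}.$$ Moreover, all the operations sending $(\mathbf{R}_w,\mathbf{R}_{w'})$ to $\mathbf{R}_{w\cdot k\cdot w'}$ ($k\in A_m$) are associative and mutually associative, so that ${}^m\mathbf{NCSF}$ can be identified with the free $As^{(m+1)}$-algebra on one generator.
   Context: $\mathbb{K}$ is a field of characteristic $0$. $\mathfrak{S}_n^{(m)}$ is the set of $m$-permutations of $n$: words over $\{1,\dots,n\}$ in which each letter occurs exactly $m$ times. An $m$-word is a word in which the number of occurrences of each letter is a multiple of $m$. The $m$-standardization $\mathrm{std}_m(w)$ of an $m$-word $w$ is obtained by iteratively scanning $w$ from left to right, labelling $1$ the first $m$ occurrences of the smallest letter, then $2$ the next $m$ occurrences of this letter or, if there are none left, the first $m$ occurrences of the next letter, and so on. ${}^m\mathbf{FQSym}$ is the graded Hopf algebra with basis $\mathbf{F}_\alpha$, $\alpha\in\mathfrak{S}_n^{(m)}$ (degree $n$), $n\ge0$, with product $\mathbf{F}_\alpha\mathbf{F}_\beta=\sum_{\gamma\in\alpha\Cup\beta}\mathbf{F}_\gamma$, where for $\alpha\in\mathfrak{S}_n^{(m)}$, $\alpha\Cup\beta$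 is the shuffle of $\alpha$ with the word $\beta[n]$ obtained from $\beta$ by adding $n$ to each letter, and coproduct $\Delta\mathbf{F}_\alpha=\sum\mathbf{F}_{\mathrm{std}_m(u)}\otimes\mathbf{F}_{\mathrm{std}_m(v)}$, sum over all factorizations $\alpha=u\cdot v$ with $u,v$ both $m$-words. For $\sigma\in\mathfrak{S}_n^{(m)}$, $n\ge1$, $\mathrm{GD}(\sigma)=w_1\cdots w_{n-1}$ is the word on $A_m$ such that the rightmost letter $i$ of $\sigma$ has exactly $w_i$ letters $i+1$ to its left, for $1\le i\le n-1$. (The sums over the sets $\mathrm{GD}(\sigma)=w$ are sums over hyposylvester classes of $m$-permutations.) An $As^{(m+1)}$-algebra is a vector space with $m+1$ binary bilinear operations $\circ_0,\dots,\circ_m$ such that $(x\circ_i y)\circ_j z=x\circ_i(y\circ_j z)$ for all $i,j$. As usual, algebras over this (nonunital) operad are compared with the positive-degree part (augmentation ideal) of the Hopf algebra, which is spanned by the $\mathbf{R}_w$; the generator is $\mathbf{R}_\emptyset=\mathbf{F}_{1^m}$. *)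

theory Defs
  imports Complex_Main "HOL-Library.Poly_Mapping" "HOL-Library.FuncSet"
begin

definition m_perms :: "nat \<Rightarrow> nat \<Rightarrow> nat list set" where
  "m_perms m n = {\<sigma>. set \<sigma> \<subseteq> {1..n} \<and> (\<forall>i\<in>{1..n}. count_list \<sigma> i = m)}"

definition m_word :: "nat \<Rightarrow> nat list \<Rightarrow> bool" where
  "m_word m w \<longleftrightarrow> (\<forall>a. m dvd count_list w a)"

text \<open>
  The iterated left-to-right scans visit the positions of w ordered by letter, and from left to
  right among equal letters. The first m positions visited are labelled 1, the next m are
  labelled 2, and so on. In an m-word every such block of m positions carries a single letter.
\<close>

definition scan_rank :: "nat list \<Rightarrow> nat \<Rightarrow> nat" where
  "scan_rank w p =
     card {q. q < length w \<and> (w ! q < w ! p \<or> (w ! q = w ! p \<and> q < p))}"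

definition std :: "nat \<Rightarrow> nat list \<Rightarrow> nat list" where
  "std m w = map (\<lambda>p. scan_rank w p div m + 1) [0..<length w]"

definition last_pos :: "nat list \<Rightarrow> nat \<Rightarrow> nat" where
  "last_pos \<sigma> i = Max {p. p < length \<sigma> \<and> \<sigma> ! p = i}"

definition GD :: "nat \<Rightarrow> nat list \<Rightarrow> nat list" where
  "GD n \<sigma> = map (\<lambda>i. count_list (take (last_pos \<sigma> i) \<sigma>) (i + 1)) [1..<n]"

abbreviation A_words :: "nat \<Rightarrow> nat list set" where
  "A_words m \<equiv> lists {0..m}"

definition fscale :: "'k::field \<Rightarrow> ('a \<Rightarrow>\<^sub>0 'k) \<Rightarrow> ('a \<Rightarrow>\<^sub>0 'k)" where
  "fscale c x = Poly_Mapping.map ((*) c) x"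

lemma lookup_fscale [simp]:
  "Poly_Mapping.lookup (fscale c x) a = c * Poly_Mapping.lookup x a"
  by (simp add: fscale_def Poly_Mapping.map.rep_eq when_def)

interpretation fvs: vector_space fscale
  by unfold_locales (auto intro!: poly_mapping_eqI simp: lookup_add algebra_simps)

text \<open>
  The tensor product of the free vector spaces on two sets is the free vector space on their
  product; \<open>tens x y\<close> is the pure tensor of x and y in this model.
\<close>

definition tens :: "('a \<Rightarrow>\<^sub>0 'k::field) \<Rightarrow> ('b \<Rightarrow>\<^sub>0 'k) \<Rightarrow> ('a \<times> 'b \<Rightarrow>\<^sub>0 'k)" where
  "tens x y = (\<Sum>a\<in>Poly_Mapping.keys x. \<Sum>b\<in>Poly_Mapping.keys y.
      Poly_Mapping.single (a, b) (Poly_Mapping.lookup x a * Poly_Mapping.lookup y b))"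

type_synonym 'k fq = "nat list \<Rightarrow>\<^sub>0 'k"

definition F :: "nat list \<Rightarrow> 'k::field fq" where
  "F \<alpha> = Poly_Mapping.single \<alpha> 1"

definition FQSym :: "nat \<Rightarrow> 'k::field fq set" where
  "FQSym m = {x. Poly_Mapping.keys x \<subseteq> (\<Union>n. m_perms m n)}"

text \<open>
  The degree of an m-permutation of n is its length divided by m. The two shuffled words have
  disjoint alphabets, so the set of shuffles has no multiplicities.
\<close>

definition shifted_shuffles :: "nat \<Rightarrow> nat list \<Rightarrow> nat list \<Rightarrow> nat list set" where
  "shifted_shuffles m \<alpha> \<beta> = shuffles \<alpha> (map ((+) (length \<alpha> div m)) \<beta>)"

definition fq_mult :: "nat \<Rightarrow> 'k::field fq \<Rightarrow> 'k fq \<Rightarrow> 'k fq" where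
  "fq_mult m x y = (\<Sum>\<alpha>\<in>Poly_Mapping.keys x. \<Sum>\<beta>\<in>Poly_Mapping.keys y.
      fscale (Poly_Mapping.lookup x \<alpha> * Poly_Mapping.lookup y \<beta>)
        (\<Sum>\<gamma>\<in>shifted_shuffles m \<alpha> \<beta>. F \<gamma>))"

definition fq_one :: "'k::field fq" where
  "fq_one = F []"

definition fq_comult :: "nat \<Rightarrow> 'k::field fq \<Rightarrow> (nat list \<times> nat list \<Rightarrow>\<^sub>0 'k)" where
  "fq_comult m x = (\<Sum>\<alpha>\<in>Poly_Mapping.keys x. fscale (Poly_Mapping.lookup x \<alpha>)
      (\<Sum>(u, v) | u @ v = \<alpha> \<and> m_word m u \<and> m_word m v. tens (F (std m u)) (F (std m v))))"

definition fq_counit :: "'k::field fq \<Rightarrow> 'k" where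
  "fq_counit x = Poly_Mapping.lookup x []"

text \<open>
  \<open>fq_conv m f g\<close> is the convolution of two linear maps f and g: the coproduct, followed by the
  tensor product of f and g, followed by the product.
\<close>

definition fq_conv ::
    "nat \<Rightarrow> ('k::field fq \<Rightarrow> 'k fq) \<Rightarrow> ('k fq \<Rightarrow> 'k fq) \<Rightarrow> 'k fq \<Rightarrow> 'k fq" where
  "fq_conv m f g x = (\<Sum>(a, b)\<in>Poly_Mapping.keys (fq_comult m x).
      fscale (Poly_Mapping.lookup (fq_comult m x) (a, b)) (fq_mult m (f (F a)) (g (F b))))"

definition linear_map_on ::
    "('k::field \<Rightarrow> 'v::ab_group_add \<Rightarrow> 'v) \<Rightarrow> 'v set \<Rightarrow>
     ('k \<Rightarrow> 'w::ab_group_add \<Rightarrow> 'w) \<Rightarrow> 'w set \<Rightarrow> ('v \<Rightarrow> 'w) \<Rightarrow> bool" where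
  "linear_map_on s V s' V' f \<longleftrightarrow>
     f \<in> V \<rightarrow> V' \<and>
     (\<forall>x\<in>V. \<forall>y\<in>V. f (x + y) = f x + f y) \<and>
     (\<forall>c. \<forall>x\<in>V. f (s c x) = s' c (f x))"

definition fq_antipode :: "nat \<Rightarrow> ('k::field fq \<Rightarrow> 'k fq) \<Rightarrow> bool" where
  "fq_antipode m S \<longleftrightarrow>
     linear_map_on fscale (FQSym m) fscale (FQSym m) S \<and>
     (\<forall>x\<in>FQSym m. fq_conv m S (\<lambda>y. y) x = fscale (fq_counit x) fq_one \<and>
                  fq_conv m (\<lambda>y. y) S x = fscale (fq_counit x) fq_one)"

definition subalgebra :: "nat \<Rightarrow> 'k::field fq set \<Rightarrow> bool" where
  "subalgebra m A \<longleftrightarrow>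
     A \<subseteq> FQSym m \<and> fvs.subspace A \<and> fq_one \<in> A \<and> (\<forall>x\<in>A. \<forall>y\<in>A. fq_mult m x y \<in> A)"

text \<open>
  The antipode is unique on \<open>FQSym m\<close>; the existential quantifier over S just names it.
\<close>

definition hopf_subalgebra :: "nat \<Rightarrow> 'k::field fq set \<Rightarrow> bool" where
  "hopf_subalgebra m A \<longleftrightarrow>
     subalgebra m A \<and>
     (\<forall>x\<in>A. fq_comult m x \<in> fvs.span {tens y z | y z. y \<in> A \<and> z \<in> A}) \<and>
     (\<exists>S. fq_antipode m S \<and> S ` A \<subseteq> A)"

text \<open>
  An m-permutation \<open>\<sigma>\<close> of \<open>n \<ge> 1\<close> has \<open>GD n \<sigma>\<close> of length \<open>n - 1\<close>, so
  \<open>GD n \<sigma> = w\<close> forces n to be the length of w plus 1.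
\<close>

definition R :: "nat \<Rightarrow> nat list \<Rightarrow> 'k::field fq" where
  "R m w = (\<Sum>\<sigma> | \<sigma> \<in> m_perms m (length w + 1) \<and> GD (length w + 1) \<sigma> = w. F \<sigma>)"

definition NCSF :: "nat \<Rightarrow> 'k::field fq set" where
  "NCSF m = subalgebra m hull (R m ` A_words m)"

definition NCSF_plus :: "nat \<Rightarrow> 'k::field fq set" where
  "NCSF_plus m = {x \<in> NCSF m. fq_counit x = 0}"

definition bilinear_op_on ::
    "('k::field \<Rightarrow> 'v::ab_group_add \<Rightarrow> 'v) \<Rightarrow> 'v set \<Rightarrow> ('v \<Rightarrow> 'v \<Rightarrow> 'v) \<Rightarrow> bool" where
  "bilinear_op_on s V f \<longleftrightarrow>
     (\<forall>x\<in>V. linear_map_on s V s V (f x)) \<and> (\<forall>y\<in>V. linear_map_on s V s V (\<lambda>x. f x y))"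

text \<open>\<open>As_algebra p\<close> has p operations, indexed by the natural numbers less than p.\<close>

definition As_algebra ::
    "nat \<Rightarrow> ('k::field \<Rightarrow> 'v::ab_group_add \<Rightarrow> 'v) \<Rightarrow> 'v set \<Rightarrow>
     (nat \<Rightarrow> 'v \<Rightarrow> 'v \<Rightarrow> 'v) \<Rightarrow> bool" where
  "As_algebra p s V op \<longleftrightarrow>
     vector_space s \<and> module.subspace s V \<and>
     (\<forall>i<p. bilinear_op_on s V (op i)) \<and>
     (\<forall>i<p. \<forall>j<p. \<forall>x\<in>V. \<forall>y\<in>V. \<forall>z\<in>V. op j (op i x y) z = op i x (op j y z))"

definition As_hom ::
    "nat \<Rightarrow> ('k::field \<Rightarrow> 'v::ab_group_add \<Rightarrow> 'v) \<Rightarrow> 'v set \<Rightarrow> (nat \<Rightarrow> 'v \<Rightarrow> 'v \<Rightarrow> 'v) \<Rightarrow>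
     ('k \<Rightarrow> 'w::ab_group_add \<Rightarrow> 'w) \<Rightarrow> 'w set \<Rightarrow> (nat \<Rightarrow> 'w \<Rightarrow> 'w \<Rightarrow> 'w) \<Rightarrow> ('v \<Rightarrow> 'w) \<Rightarrow> bool"
  where
  "As_hom p s V op s' V' op' \<phi> \<longleftrightarrow>
     linear_map_on s V s' V' \<phi> \<and>
     (\<forall>i<p. \<forall>x\<in>V. \<forall>y\<in>V. \<phi> (op i x y) = op' i (\<phi> x) (\<phi> y))"

text \<open>
  Freeness on the single generator g, by the universal property. The competing algebras are all
  those carried by a subspace of some vector space on the type \<open>'w\<close>; a theorem that leaves
  \<open>'w\<close> arbitrary covers all algebras. Homomorphisms are taken as extensional functions so that
  they are determined by their values on V.
\<close>

definition free_As_algebra ::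
    "'w::ab_group_add itself \<Rightarrow> nat \<Rightarrow> ('k::field \<Rightarrow> 'v::ab_group_add \<Rightarrow> 'v) \<Rightarrow> 'v set \<Rightarrow>
     (nat \<Rightarrow> 'v \<Rightarrow> 'v \<Rightarrow> 'v) \<Rightarrow> 'v \<Rightarrow> bool" where
  "free_As_algebra W p s V op g \<longleftrightarrow>
     As_algebra p s V op \<and> g \<in> V \<and>
     (\<forall>(s' :: 'k \<Rightarrow> 'w \<Rightarrow> 'w) V' op' b. As_algebra p s' V' op' \<and> b \<in> V' \<longrightarrow>
        (\<exists>!\<phi>. \<phi> \<in> extensional V \<and> As_hom p s V op s' V' op' \<phi> \<and> \<phi> g = b))"

definition R_operations :: "nat \<Rightarrow> (nat \<Rightarrow> 'k::field fq \<Rightarrow> 'k fq \<Rightarrow> 'k fq) \<Rightarrow> bool" where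
  "R_operations m op \<longleftrightarrow>
     (\<forall>k\<le>m. bilinear_op_on fscale (NCSF_plus m) (op k) \<and>
       (\<forall>w\<in>A_words m. \<forall>w'\<in>A_words m. op k (R m w) (R m w') = R m (w @ [k] @ w')))"

end

theory Submission
  imports Defs
begin

text \<open>
  An element of \<open>FQSym m\<close> lies in \<open>NCSF m\<close> iff its coefficient at \<open>\<sigma>\<close> depends on \<open>\<sigma>\<close> only through
  the word \<open>GD \<sigma>\<close>. The coefficient of \<open>x y\<close> at \<open>\<gamma>\<close> is the sum over p of x at the restriction of
  \<open>\<gamma>\<close> to the letters up to p times y at the remaining letters, and these restrictions delete one
  letter from \<open>GD \<gamma>\<close>: this gives closure under products and the product formula. The coefficient
  of the coproduct of x at \<open>a \<otimes> b\<close> is the sum, over the sets I of letters of a, of x at the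
  concatenation of a relabelled by I and b relabelled by the complement of I; for fixed I the
  descent word of this concatenation depends only on \<open>GD a\<close> and \<open>GD b\<close>. The antipode is the
  convolution inverse of the identity, computed by recursion on the degree; the recursion only uses
  products and coproducts, so it stays inside \<open>NCSF m\<close>. Every word w is the descent word
  of some permutation, so the elements \<open>R w\<close> with a word w form a basis of the augmentation ideal,
  and inserting a letter between two words is the free \<open>As\<close> structure.
\<close>

section \<open>Linear extension\<close>

text \<open>The algebra generated by the \<open>R m w\<close> is a hull without explicit elements,
  whereas a condition on coefficients can be tested at one basis word at a time. Separating the
  letters at p keeps every entry of the descent word except the one that compares p with p + 1,
  because these two letters land in different factors; this free entry is the k of the product
  formula. For the coproduct, a pair i, i + 1 inside I has consecutive ranks, so its entry is read
  off a, and likewise for b; a pair split between I and its complement has entry 0 or m, whatever a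
  and b are. The obstacle is the antipode: to see that a one-sided convolution inverse is two-sided
  one needs coassociativity, but the coproduct only cuts between m-words and standardizes both
  factors. The convolution is therefore carried out on arbitrary words with all cuts, where
  coassociativity is that of concatenation, for functions that vanish off the m-words and do not
  feel standardization.\<close>

definition lin_ext ::
    "('k::field \<Rightarrow> 'v::ab_group_add \<Rightarrow> 'v) \<Rightarrow> ('a \<Rightarrow> 'v) \<Rightarrow> ('a \<Rightarrow>\<^sub>0 'k) \<Rightarrow> 'v" where
  "lin_ext s f x = (\<Sum>a\<in>Poly_Mapping.keys x. s (Poly_Mapping.lookup x a) (f a))"

context vector_space
begin

text \<open>Zero coefficients contribute nothing, so elements with different supports can be
  expanded over one index set.\<close>

lemma lin_ext_superset:
  assumes "finite A" "Poly_Mapping.keys x \<subseteq> A"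
  shows "lin_ext scale f x = (\<Sum>a\<in>A. scale (Poly_Mapping.lookup x a) (f a))"
  unfolding lin_ext_def
  by (rule sum.mono_neutral_left) (use assms in \<open>auto simp: in_keys_iff\<close>)

lemma lin_ext_add: "lin_ext scale f (x + y) = lin_ext scale f x + lin_ext scale f y"
proof -
  let ?A = "Poly_Mapping.keys x \<union> Poly_Mapping.keys y"
  have k: "Poly_Mapping.keys (x + y) \<subseteq> ?A"
    by (rule Poly_Mapping.keys_add)
  have "lin_ext scale f (x + y) = (\<Sum>a\<in>?A. scale (Poly_Mapping.lookup (x + y) a) (f a))"
    by (rule lin_ext_superset) (use k in auto)
  also have "\<dots> = (\<Sum>a\<in>?A. scale (Poly_Mapping.lookup x a) (f a))
      + (\<Sum>a\<in>?A. scale (Poly_Mapping.lookup y a) (f a))"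
    by (simp add: lookup_add scale_left_distrib sum.distrib)
  also have "\<dots> = lin_ext scale f x + lin_ext scale f y"
    by (subst (1 2) lin_ext_superset[of ?A]) auto
  finally show ?thesis .
qed

lemma lin_ext_scale: "lin_ext scale f (fscale c x) = scale c (lin_ext scale f x)"
proof -
  have "lin_ext scale f (fscale c x)
      = (\<Sum>a\<in>Poly_Mapping.keys x. scale (Poly_Mapping.lookup (fscale c x) a) (f a))"
    by (rule lin_ext_superset) (auto simp: in_keys_iff)
  then show ?thesis
    by (simp add: lin_ext_def scale_sum_right)
qed

lemma lin_ext_zero [simp]: "lin_ext scale f 0 = 0"
  by (simp add: lin_ext_def)

lemma lin_ext_fun_zero [simp]: "lin_ext scale (\<lambda>a. 0) x = 0"
  by (simp add: lin_ext_def)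

lemma lin_ext_single [simp]: "lin_ext scale f (Poly_Mapping.single a c) = scale c (f a)"
  by (simp add: lin_ext_def)

lemma lin_ext_sum: "lin_ext scale f (\<Sum>i\<in>I. x i) = (\<Sum>i\<in>I. lin_ext scale f (x i))"
  by (induction I rule: infinite_finite_induct) (auto simp: lin_ext_add)

lemma lin_ext_fun_add:
  "lin_ext scale (\<lambda>a. f a + g a) x = lin_ext scale f x + lin_ext scale g x"
  by (simp add: lin_ext_def scale_right_distrib sum.distrib)

lemma lin_ext_fun_scale: "lin_ext scale (\<lambda>a. scale c (f a)) x = scale c (lin_ext scale f x)"
  by (simp add: lin_ext_def scale_sum_right mult.commute)

lemma lin_ext_fun_sum:
  "lin_ext scale (\<lambda>a. \<Sum>i\<in>I. f i a) x = (\<Sum>i\<in>I. lin_ext scale (f i) x)"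
  unfolding lin_ext_def scale_sum_right by (rule sum.swap)

lemma lin_ext_lin_ext:
  "lin_ext scale f (lin_ext fscale h x) = lin_ext scale (\<lambda>a. lin_ext scale f (h a)) x"
  unfolding lin_ext_def[of fscale h] lin_ext_sum lin_ext_scale by (simp add: lin_ext_def)

lemma lin_ext_in_subspace:
  assumes "subspace V" "\<And>a. a \<in> Poly_Mapping.keys x \<Longrightarrow> f a \<in> V"
  shows "lin_ext scale f x \<in> V"
  unfolding lin_ext_def by (intro subspace_sum subspace_scale assms)

lemma lin_ext_cong:
  "(\<And>a. a \<in> Poly_Mapping.keys x \<Longrightarrow> f a = g a) \<Longrightarrow> lin_ext scale f x = lin_ext scale g x"
  by (simp add: lin_ext_def)

end

lemma lookup_lin_ext:
  "Poly_Mapping.lookup (lin_ext fscale f x) b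
     = lin_ext (*) (\<lambda>a. Poly_Mapping.lookup (f a) b) x"
  by (simp add: lin_ext_def lookup_sum)

lemma lin_ext_mult_delta: "lin_ext (*) (\<lambda>a. if a = b then 1 else 0) x = Poly_Mapping.lookup x b"
  by (simp add: lin_ext_def in_keys_iff if_distrib cong: if_cong)

lemma lin_ext_F: "lin_ext fscale F x = x"
  by (rule poly_mapping_eqI) (simp add: lookup_lin_ext F_def lookup_single when_def lin_ext_mult_delta)

lemma lookup_F: "Poly_Mapping.lookup (F \<alpha> :: 'k::field fq) \<beta> = (if \<alpha> = \<beta> then 1 else 0)"
  by (simp add: F_def lookup_single when_def)

text \<open>Grouping the basis expansion by the value of \<open>h\<close> leaves one common
  coefficient per fibre. This serves for descent classes and, with \<open>h\<close> on pairs of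
  words, for the coproduct.\<close>

lemma fibre_const_in_span:
  fixes x :: "'a \<Rightarrow>\<^sub>0 'k::field"
  assumes Z: "finite Z" "Poly_Mapping.keys x \<subseteq> Z"
    and const: "\<And>y z. y \<in> Z \<Longrightarrow> z \<in> Z \<Longrightarrow> h y = h z \<Longrightarrow>
      Poly_Mapping.lookup x y = Poly_Mapping.lookup x z"
  shows "x \<in> fvs.span ((\<lambda>y. \<Sum>z | z \<in> Z \<and> h z = h y. Poly_Mapping.single z 1) ` Z)"
proof -
  have "x = (\<Sum>z\<in>Z. fscale (Poly_Mapping.lookup x z) (Poly_Mapping.single z 1))"
    using Z by (intro poly_mapping_eqI)
      (auto simp: lookup_sum lookup_single when_def in_keys_iff if_distrib cong: if_cong)
  also have "\<dots> = (\<Sum>c\<in>h ` Z. \<Sum>z | z \<in> Z \<and> h z = c.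
      fscale (Poly_Mapping.lookup x z) (Poly_Mapping.single z 1))"
    by (rule sum.group[symmetric]) (use Z in auto)
  also have "\<dots> \<in> fvs.span ((\<lambda>y. \<Sum>z | z \<in> Z \<and> h z = h y. Poly_Mapping.single z 1) ` Z)"
  proof (rule fvs.span_sum)
    fix c assume "c \<in> h ` Z"
    then obtain y where y: "y \<in> Z" "c = h y" by auto
    have "(\<Sum>z | z \<in> Z \<and> h z = c. fscale (Poly_Mapping.lookup x z) (Poly_Mapping.single z 1))
        = fscale (Poly_Mapping.lookup x y) (\<Sum>z | z \<in> Z \<and> h z = h y. Poly_Mapping.single z 1)"
      unfolding fvs.scale_sum_right y
    proof (rule sum.cong[OF refl])
      fix z assume "z \<in> {z \<in> Z. h z = h y}"
      then have "Poly_Mapping.lookup x z = Poly_Mapping.lookup x y"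
        using const[of z y] y by simp
      then show "fscale (Poly_Mapping.lookup x z) (Poly_Mapping.single z 1)
          = fscale (Poly_Mapping.lookup x y) (Poly_Mapping.single z 1)"
        by (rule arg_cong)
    qed
    also have "\<dots> \<in> fvs.span ((\<lambda>y. \<Sum>z | z \<in> Z \<and> h z = h y. Poly_Mapping.single z 1) ` Z)"
      using y by (intro fvs.span_scale fvs.span_base) auto
    finally show "(\<Sum>z | z \<in> Z \<and> h z = c. fscale (Poly_Mapping.lookup x z)
        (Poly_Mapping.single z 1)) \<in> \<dots>" .
  qed
  finally show ?thesis .
qed

section \<open>Tensors and the structure maps as linear extensions\<close>

lemma lookup_tens:
  "Poly_Mapping.lookup (tens x y) (a, b) = Poly_Mapping.lookup x a * Poly_Mapping.lookup y b"
proof -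
  have "Poly_Mapping.lookup (tens x y) (a, b)
      = (\<Sum>a'\<in>Poly_Mapping.keys x. \<Sum>b'\<in>Poly_Mapping.keys y. if a' = a \<and> b' = b then
          Poly_Mapping.lookup x a' * Poly_Mapping.lookup y b' else 0)"
    by (simp add: tens_def lookup_sum lookup_single when_def)
  also have "\<dots> = (\<Sum>a'\<in>Poly_Mapping.keys x. if a' = a then
      (\<Sum>b'\<in>Poly_Mapping.keys y. if b' = b then
          Poly_Mapping.lookup x a' * Poly_Mapping.lookup y b' else 0) else 0)"
    by (rule sum.cong) auto
  also have "\<dots> = Poly_Mapping.lookup x a * Poly_Mapping.lookup y b"
    by (simp add: in_keys_iff)
  finally show ?thesis .
qed

lemma tens_F: "tens (F a) (F b) = Poly_Mapping.single (a, b) 1"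
  by (simp add: tens_def F_def)

lemma (in vector_space) lin_ext_tens:
  "lin_ext scale f (tens x y) = lin_ext scale (\<lambda>a. lin_ext scale (\<lambda>b. f (a, b)) y) x"
  by (simp add: tens_def lin_ext_sum lin_ext_def[of scale _ x] lin_ext_def[of scale _ y] scale_sum_right)

text \<open>As an iterated linear extension, the product inherits bilinearity from
  \<open>lin_ext\<close> without any argument about supports.\<close>

lemma fq_mult_lin_ext:
  "fq_mult m x y
     = lin_ext fscale (\<lambda>\<alpha>. lin_ext fscale (\<lambda>\<beta>. \<Sum>\<gamma>\<in>shifted_shuffles m \<alpha> \<beta>. F \<gamma>) y) x"
  by (simp add: fq_mult_def lin_ext_def fvs.scale_sum_right)

lemma fq_comult_lin_ext:
  "fq_comult m x = lin_ext fscale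
     (\<lambda>\<alpha>. \<Sum>(u, v) | u @ v = \<alpha> \<and> m_word m u \<and> m_word m v. tens (F (std m u)) (F (std m v))) x"
  by (simp add: fq_comult_def lin_ext_def)

lemma fq_conv_lin_ext:
  "fq_conv m f g x = lin_ext fscale (\<lambda>(a, b). fq_mult m (f (F a)) (g (F b))) (fq_comult m x)"
  by (simp add: fq_conv_def lin_ext_def case_prod_unfold)

lemma fq_mult_scale_left: "fq_mult m (fscale c x) z = fscale c (fq_mult m x z)"
  and fq_mult_scale_right: "fq_mult m z (fscale c x) = fscale c (fq_mult m z x)"
  by (simp_all add: fq_mult_lin_ext fvs.lin_ext_scale fvs.lin_ext_fun_scale)

lemma fq_mult_zero_left [simp]: "fq_mult m 0 z = 0"
  and fq_mult_zero_right [simp]: "fq_mult m z 0 = 0"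
  by (simp_all add: fq_mult_def)

lemma fq_mult_sum_left: "fq_mult m (\<Sum>i\<in>I. x i) z = (\<Sum>i\<in>I. fq_mult m (x i) z)"
  by (simp add: fq_mult_lin_ext fvs.lin_ext_sum)

lemma fq_mult_sum_right: "fq_mult m z (\<Sum>i\<in>I. x i) = (\<Sum>i\<in>I. fq_mult m z (x i))"
  by (simp add: fq_mult_lin_ext fvs.lin_ext_sum fvs.lin_ext_fun_sum)

lemma fq_mult_one_left [simp]: "fq_mult m fq_one x = x"
  by (simp add: map_idI fq_mult_lin_ext fq_one_def F_def[of "[]"] shifted_shuffles_def lin_ext_F)

lemma fq_mult_one_right [simp]: "fq_mult m x fq_one = x"
  by (simp add: fq_mult_lin_ext fq_one_def F_def[of "[]"] shifted_shuffles_def lin_ext_F)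

section \<open>The product in coordinates\<close>

text \<open>The number of letters j to the left of the last i, by structural recursion instead of
  the maximum in \<open>last_pos\<close>: the head lies to the left of the last i iff i still occurs
  in the tail. The value is 0 if i does not occur.\<close>

fun before_last :: "'a list \<Rightarrow> 'a \<Rightarrow> 'a \<Rightarrow> nat" where
  "before_last [] i j = 0"
| "before_last (x # xs) i j =
     (if i \<in> set xs then (if x = j then 1 else 0) + before_last xs i j else 0)"

lemma last_pos_Cons:
  assumes "i \<in> set (x # xs)"
  shows "last_pos (x # xs) i = (if i \<in> set xs then Suc (last_pos xs i) else 0)"
proof (cases "i \<in> set xs")
  case True
  let ?P = "{p. p < length xs \<and> xs ! p = i}"
  have ne: "?P \<noteq> {}" using True by (auto simp: in_set_conv_nth)
  have eq: "{p. p < length (x # xs) \<and> (x # xs) ! p = i} = Suc ` ?P \<union> (if x = i then {0} else {})"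
    (is "?L = ?R")
  proof (rule set_eqI)
    fix p show "p \<in> ?L \<longleftrightarrow> p \<in> ?R" by (cases p) auto
  qed
  have "Max (Suc ` ?P) = Suc (Max ?P)"
    using ne by (intro mono_Max_commute[symmetric]) (auto simp: mono_def)
  moreover have "Max (Suc ` ?P \<union> (if x = i then {0} else {})) = Max (Suc ` ?P)"
    by (cases "x = i") (use ne in simp_all)
  ultimately show ?thesis
    using True by (simp only: last_pos_def eq if_True)
next
  case False
  then have "{p. p < length (x # xs) \<and> (x # xs) ! p = i} = {0}"
    (is "?L = _")
  proof (intro set_eqI)
    fix p show "p \<in> ?L \<longleftrightarrow> p \<in> {0}" using assms False by (cases p) auto
  qed
  then show ?thesis using False by (simp only: last_pos_def if_False Max_singleton)
qed

lemma count_before_last: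
  "i \<in> set \<sigma> \<Longrightarrow> count_list (take (last_pos \<sigma> i) \<sigma>) j = before_last \<sigma> i j"
proof (induction \<sigma>)
  case (Cons x xs)
  then show ?case by (auto simp: last_pos_Cons)
qed simp

text \<open>If i occurs in v, its last occurrence is there and all of u lies to its left; otherwise
  nothing of v is counted.\<close>

lemma before_last_append:
  "before_last (u @ v) i j = (if i \<in> set v then count_list u j + before_last v i j
     else before_last u i j)"
  by (induction u) (cases v; auto)+

lemma before_last_map:
  "inj_on f (insert i (insert j (set u))) \<Longrightarrow> before_last (map f u) (f i) (f j) = before_last u i j"
proof (induction u)
  case (Cons x xs)
  have "inj_on f (insert i (insert j (set xs)))"
    by (rule inj_on_subset[OF Cons.prems]) auto
  moreover have "f i \<in> f ` set xs \<longleftrightarrow> i \<in> set xs"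
    by (rule inj_on_image_mem_iff[OF Cons.prems]) auto
  moreover have "f x = f j \<longleftrightarrow> x = j"
    using Cons.prems by (auto simp: inj_on_def)
  ultimately show ?case using Cons.IH by simp
qed simp

lemma before_last_notin_left: "i \<notin> set u \<Longrightarrow> before_last u i j = 0"
  by (cases u) auto

lemma before_last_filter:
  "P i \<Longrightarrow> P j \<Longrightarrow> before_last (filter P u) i j = before_last u i j"
  by (induction u) (auto simp: before_last_notin_left)

lemma before_last_le: "before_last u i j \<le> count_list u j"
  by (induction u) auto

lemma before_last_notin_right: "j \<notin> set u \<Longrightarrow> before_last u i j = 0"
  by (induction u) auto

lemma count_list_filter: "count_list (filter P u) i = (if P i then count_list u i else 0)"
  by (induction u) auto

text \<open>Both sides run over the pairs with p + q \<le> n. This is the reindexing behind the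
  associativity of the product and of the convolution of word functions.\<close>

lemma sum_triangle:
  fixes f :: "nat \<Rightarrow> nat \<Rightarrow> 'a::comm_monoid_add"
  shows "(\<Sum>r\<le>n. \<Sum>p\<le>r. f p (r - p)) = (\<Sum>p\<le>n. \<Sum>q\<le>n - p. f p q)"
proof -
  have "(\<Sum>p\<le>n. \<Sum>q\<le>n - p. f p q) = (\<Sum>(p, q)\<in>Sigma {..n} (\<lambda>p. {..n - p}). f p q)"
    by (simp add: sum.Sigma)
  also have "Sigma {..n} (\<lambda>p. {..n - p}) = {(p, q). p + q \<le> n}"
    by auto
  finally show ?thesis by (simp add: sum.triangle_reindex_eq)
qed

section \<open>m-permutations and the ambient space\<close>

lemma m_perms_0: "m_perms m 0 = {[]}"
  by (auto simp: m_perms_def)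

lemma length_m_perms: "\<sigma> \<in> m_perms m n \<Longrightarrow> length \<sigma> = m * n"
proof -
  assume \<sigma>: "\<sigma> \<in> m_perms m n"
  then have "length \<sigma> = sum (count_list \<sigma>) {1..n}"
    by (intro sum_count_set[symmetric]) (auto simp: m_perms_def)
  also have "\<dots> = (\<Sum>i\<in>{1..n}. m)"
    using \<sigma> by (intro sum.cong) (auto simp: m_perms_def)
  finally show ?thesis by simp
qed

lemma finite_m_perms [simp, intro]: "finite (m_perms m n)"
  by (rule finite_subset[OF _ finite_lists_length_eq[of "{1..n}" "m * n"]])
    (auto simp: length_m_perms, auto simp: m_perms_def)

lemma subspace_FQSym: "fvs.subspace (FQSym m :: 'k::field fq set)"
proof (rule fvs.subspaceI)
  fix x y :: "'k fq" and c :: 'k assume x: "x \<in> FQSym m" and y: "y \<in> FQSym m"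
  show "x + y \<in> FQSym m"
    using x y Poly_Mapping.keys_add[of x y] unfolding FQSym_def by blast
  have "Poly_Mapping.keys (fscale c x) \<subseteq> Poly_Mapping.keys x" by (auto simp: in_keys_iff)
  then show "fscale c x \<in> FQSym m"
    using x unfolding FQSym_def by blast
qed (simp add: FQSym_def)

lemma F_in_FQSym: "\<alpha> \<in> m_perms m n \<Longrightarrow> F \<alpha> \<in> FQSym m"
  by (auto simp: F_def FQSym_def)

lemma fq_one_in_FQSym: "fq_one \<in> FQSym m"
  unfolding fq_one_def by (rule F_in_FQSym[of _ m 0]) (simp add: m_perms_0)

section \<open>Restriction of a word to its small and to its large letters\<close>

definition lo :: "nat \<Rightarrow> nat list \<Rightarrow> nat list" where
  "lo p \<gamma> = filter (\<lambda>i. i \<le> p) \<gamma>"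

definition hi :: "nat \<Rightarrow> nat list \<Rightarrow> nat list" where
  "hi p \<gamma> = map (\<lambda>i. i - p) (filter (\<lambda>i. p < i) \<gamma>)"

lemma lo_lo: "p \<le> r \<Longrightarrow> lo p (lo r \<gamma>) = lo p \<gamma>"
  by (auto simp: lo_def intro: filter_cong)

text \<open>Both sides are the band of letters above p and up to r, lowered by p; it is the middle
  factor in the proof of associativity.\<close>

lemma hi_lo: "p \<le> r \<Longrightarrow> hi p (lo r \<gamma>) = lo (r - p) (hi p \<gamma>)"
  by (auto simp: lo_def hi_def filter_map comp_def intro!: arg_cong[where f = "map _"] filter_cong)

lemma hi_hi: "hi q (hi p \<gamma>) = hi (p + q) \<gamma>"
  by (auto simp: hi_def filter_map comp_def intro!: map_cong filter_cong)

lemma lo_in_m_perms: "\<gamma> \<in> m_perms m n \<Longrightarrow> p \<le> n \<Longrightarrow> lo p \<gamma> \<in> m_perms m p"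
  by (auto simp: m_perms_def lo_def count_list_filter)

lemma count_list_map_inj_on:
  "inj_on f (insert i (set u)) \<Longrightarrow> count_list (map f u) (f i) = count_list u i"
  by (induction u) (auto simp: inj_on_def)

lemma inj_on_shift_down: "inj_on (\<lambda>i. i - p) {i. p < (i::nat)}"
  by (auto simp: inj_on_def)

lemma finite_shifted_shuffles [simp]: "finite (shifted_shuffles m \<alpha> \<beta>)"
  by (simp add: shifted_shuffles_def)

lemma FQSym_eqI:
  assumes "x \<in> FQSym m" "y \<in> FQSym m"
    and "\<And>n \<gamma>. \<gamma> \<in> m_perms m n \<Longrightarrow> Poly_Mapping.lookup x \<gamma> = Poly_Mapping.lookup y \<gamma>"
  shows "x = y"
proof (rule poly_mapping_eqI)
  fix \<gamma>
  show "Poly_Mapping.lookup x \<gamma> = Poly_Mapping.lookup y \<gamma>"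
  proof (cases "\<exists>n. \<gamma> \<in> m_perms m n")
    case False
    then have "\<gamma> \<notin> Poly_Mapping.keys x" "\<gamma> \<notin> Poly_Mapping.keys y"
      using assms by (auto simp: FQSym_def)
    then show ?thesis by (simp add: in_keys_iff)
  qed (use assms in auto)
qed

context
  fixes m :: nat
  assumes m_pos: "m \<ge> 1"
begin

lemma m_perms_degree: "\<sigma> \<in> m_perms m n \<Longrightarrow> length \<sigma> div m = n"
  using m_pos length_m_perms by simp

lemma m_perms_unique: "\<sigma> \<in> m_perms m n \<Longrightarrow> \<sigma> \<in> m_perms m n' \<Longrightarrow> n = n'"
  using m_perms_degree by blast

lemma set_m_perms: "\<sigma> \<in> m_perms m n \<Longrightarrow> set \<sigma> = {1..n}"
proof -
  assume "\<sigma> \<in> m_perms m n"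
  then have "set \<sigma> \<subseteq> {1..n}" "\<And>i. i \<in> {1..n} \<Longrightarrow> count_list \<sigma> i \<noteq> 0"
    using m_pos by (auto simp: m_perms_def)
  then show ?thesis by (auto simp: count_list_0_iff)
qed

lemma Nil_in_m_perms: "[] \<in> m_perms m n \<longleftrightarrow> n = 0"
  using m_perms_0 set_m_perms[of "[]" n] by auto

lemma GD_before_last:
  "\<sigma> \<in> m_perms m n \<Longrightarrow> GD n \<sigma> = map (\<lambda>i. before_last \<sigma> i (i + 1)) [1..<n]"
  unfolding GD_def by (rule map_cong) (auto simp: count_before_last set_m_perms)

lemma length_GD [simp]: "length (GD n \<sigma>) = n - 1"
  by (simp add: GD_def)

lemma GD_in_A_words: "\<sigma> \<in> m_perms m n \<Longrightarrow> GD n \<sigma> \<in> A_words m"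
proof -
  assume \<sigma>: "\<sigma> \<in> m_perms m n"
  have "before_last \<sigma> i (i + 1) \<le> m" if "i \<in> {1..<n}" for i
    using before_last_le[of \<sigma> i "i + 1"] \<sigma> that by (auto simp: m_perms_def)
  then show ?thesis using \<sigma> by (auto simp: GD_before_last lists_eq_set)
qed

lemma GD_nth: "\<sigma> \<in> m_perms m n \<Longrightarrow> i < n - 1 \<Longrightarrow> GD n \<sigma> ! i = before_last \<sigma> (i + 1) (i + 2)"
  by (simp add: GD_before_last)

lemma GD_eqD:
  "\<sigma> \<in> m_perms m n \<Longrightarrow> \<tau> \<in> m_perms m n \<Longrightarrow> GD n \<sigma> = GD n \<tau> \<Longrightarrow> i \<in> {1..<n} \<Longrightarrow>
    before_last \<sigma> i (i + 1) = before_last \<tau> i (i + 1)"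
  by (simp add: GD_before_last)

lemma hi_in_m_perms:
  assumes "\<gamma> \<in> m_perms m n" "p \<le> n" shows "hi p \<gamma> \<in> m_perms m (n - p)"
proof -
  have "count_list (hi p \<gamma>) i = m" if i: "i \<in> {1..n - p}" for i
  proof -
    have "count_list (map (\<lambda>i. i - p) (filter (\<lambda>i. p < i) \<gamma>)) (i + p - p)
        = count_list (filter (\<lambda>i. p < i) \<gamma>) (i + p)"
      by (rule count_list_map_inj_on[where f = "\<lambda>i. i - p"],
          rule inj_on_subset[OF inj_on_shift_down[of p]]) (use i in auto)
    then show ?thesis using i assms by (auto simp: hi_def count_list_filter m_perms_def)
  qed
  moreover have "set (hi p \<gamma>) \<subseteq> {1..n - p}"
    using set_m_perms[OF assms(1)] by (auto simp: hi_def)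
  ultimately show ?thesis by (simp add: m_perms_def)
qed

text \<open>An entry depends only on the relative order of two neighbouring letters, which erasing
  other letters preserves. The letters up to p give the entries for i = 1, ..., p - 1; for p = 0 the
  truncated subtraction correctly yields the empty word.\<close>

lemma GD_lo: "\<gamma> \<in> m_perms m n \<Longrightarrow> p \<le> n \<Longrightarrow> GD p (lo p \<gamma>) = take (p - 1) (GD n \<gamma>)"
  by (rule nth_equalityI)
    (auto simp: GD_nth lo_in_m_perms, auto simp: lo_def before_last_filter)

text \<open>List positions start at 0, so dropping p of them removes the entries for i = 1, ..., p.
  Hence for 0 < p < n the entry for the pair p, p + 1 is the only one that neither restriction
  keeps.\<close>

lemma GD_hi:
  assumes "\<gamma> \<in> m_perms m n" "p \<le> n" shows "GD (n - p) (hi p \<gamma>) = drop p (GD n \<gamma>)"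
proof (rule nth_equalityI)
  fix i assume "i < length (GD (n - p) (hi p \<gamma>))"
  then have i: "i < n - p - 1" by simp
  have "before_last (map (\<lambda>i. i - p) (filter (\<lambda>i. p < i) \<gamma>)) (i + p + 1 - p) (i + p + 2 - p)
      = before_last (filter (\<lambda>i. p < i) \<gamma>) (i + p + 1) (i + p + 2)"
    by (rule before_last_map[where f = "\<lambda>i. i - p"],
        rule inj_on_subset[OF inj_on_shift_down[of p]]) auto
  then have "before_last (hi p \<gamma>) (i + 1) (i + 2) = before_last \<gamma> (i + p + 1) (i + p + 2)"
    by (simp add: hi_def before_last_filter)
  then show "GD (n - p) (hi p \<gamma>) ! i = drop p (GD n \<gamma>) ! i"
    using assms i by (simp add: GD_nth hi_in_m_perms add.commute add.left_commute)
qed simp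

text \<open>The two alphabets are disjoint, so a word is a shuffle iff separating its letters at p
  returns the two words; its multiplicities are then those of \<alpha> and \<beta>.\<close>

lemma shifted_shuffles_iff:
  assumes \<alpha>: "\<alpha> \<in> m_perms m p" and \<beta>: "\<beta> \<in> m_perms m q"
  shows "\<gamma> \<in> shifted_shuffles m \<alpha> \<beta>
    \<longleftrightarrow> \<gamma> \<in> m_perms m (p + q) \<and> lo p \<gamma> = \<alpha> \<and> hi p \<gamma> = \<beta>"
proof -
  have s: "shifted_shuffles m \<alpha> \<beta> = partition (\<lambda>i. i \<le> p) -` {(\<alpha>, map ((+) p) \<beta>)}"
    unfolding shifted_shuffles_def m_perms_degree[OF \<alpha>]
    by (rule inv_image_partition[symmetric])
      (use set_m_perms[OF \<alpha>] set_m_perms[OF \<beta>] in auto)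
  have eq: "filter (\<lambda>i. \<not> i \<le> p) \<gamma> = map ((+) p) \<beta> \<longleftrightarrow> hi p \<gamma> = \<beta>"
  proof
    assume "filter (\<lambda>i. \<not> i \<le> p) \<gamma> = map ((+) p) \<beta>"
    then show "hi p \<gamma> = \<beta>" by (simp add: hi_def not_le comp_def)
  next
    assume "hi p \<gamma> = \<beta>"
    then show "filter (\<lambda>i. \<not> i \<le> p) \<gamma> = map ((+) p) \<beta>"
      by (auto simp: hi_def not_le comp_def intro!: map_idI[symmetric])
  qed
  have "\<gamma> \<in> m_perms m (p + q)" if lo: "lo p \<gamma> = \<alpha>" and hi: "filter (\<lambda>i. \<not> i \<le> p) \<gamma> = map ((+) p) \<beta>"
  proof -
    have 1: "set \<gamma> \<subseteq> {1..p + q}"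
    proof
      fix i assume "i \<in> set \<gamma>"
      then have "i \<in> set (lo p \<gamma>) \<or> i \<in> set (filter (\<lambda>i. \<not> i \<le> p) \<gamma>)"
        by (auto simp: lo_def)
      then show "i \<in> {1..p + q}"
        unfolding lo hi using set_m_perms[OF \<alpha>] set_m_perms[OF \<beta>] by auto
    qed
    have "count_list \<gamma> i = m" if i: "i \<in> {1..p + q}" for i
    proof (cases "i \<le> p")
      case True
      then have "count_list \<gamma> i = count_list (lo p \<gamma>) i"
        by (simp add: lo_def count_list_filter)
      then show ?thesis using \<alpha> True i unfolding lo by (auto simp: m_perms_def)
    next
      case False
      then have "count_list \<gamma> i = count_list (filter (\<lambda>i. \<not> i \<le> p) \<gamma>) (p + (i - p))"
        by (simp add: count_list_filter)
      also have "\<dots> = count_list \<beta> (i - p)"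
        unfolding hi by (rule count_list_map_inj_on) auto
      also have "\<dots> = m"
      proof -
        have "i - p \<in> {1..q}" using False i by auto
        then show ?thesis using \<beta> unfolding m_perms_def by blast
      qed
      finally show ?thesis .
    qed
    with 1 show ?thesis by (auto simp: m_perms_def)
  qed
  then show ?thesis
    unfolding s using eq by (auto simp: lo_def comp_def)
qed

text \<open>Only p = p' can contribute. Summing over all p removes the degrees of \<alpha> and
  \<beta> from the formula, so that it extends to elements of mixed degree.\<close>

lemma lookup_shuffle_sum:
  assumes "\<alpha> \<in> m_perms m p'" "\<beta> \<in> m_perms m q'" "\<gamma> \<in> m_perms m n"
  shows "(\<Sum>\<delta>\<in>shifted_shuffles m \<alpha> \<beta>. Poly_Mapping.lookup (F \<delta>) \<gamma> :: 'k::field)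
    = (\<Sum>p\<le>n. (if \<alpha> = lo p \<gamma> then 1 else 0) * (if \<beta> = hi p \<gamma> then 1 else 0))"
proof -
  \<comment> \<open>The degree of \<open>lo p \<gamma>\<close> is p, so the equation fixes
    p.\<close>
  have u: "p = p'" if "p \<le> n" "\<alpha> = lo p \<gamma>" for p
    using that assms lo_in_m_perms m_perms_unique by metis
  have "(\<Sum>\<delta>\<in>shifted_shuffles m \<alpha> \<beta>. Poly_Mapping.lookup (F \<delta>) \<gamma> :: 'k)
      = (if \<gamma> \<in> shifted_shuffles m \<alpha> \<beta> then 1 else 0)"
    by (simp add: lookup_F)
  also have "\<gamma> \<in> shifted_shuffles m \<alpha> \<beta> \<longleftrightarrow> p' \<le> n \<and> \<alpha> = lo p' \<gamma> \<and> \<beta> = hi p' \<gamma>"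
  proof -
    have "n = p' + q'" if "p' \<le> n" "\<beta> = hi p' \<gamma>"
      using that assms hi_in_m_perms[of \<gamma> n p'] m_perms_unique[of \<beta> q' "n - p'"] by auto
    moreover have "n = p' + q'" if "\<gamma> \<in> m_perms m (p' + q')"
      using that assms m_perms_unique by blast
    ultimately show ?thesis
      using assms by (auto simp: shifted_shuffles_iff[OF assms(1,2)])
  qed
  also have "(if p' \<le> n \<and> \<alpha> = lo p' \<gamma> \<and> \<beta> = hi p' \<gamma> then 1 else 0 :: 'k)
      = (\<Sum>p\<le>n. if p = p' then (if \<alpha> = lo p \<gamma> then 1 else 0) * (if \<beta> = hi p \<gamma> then 1 else 0) else 0)"
    by simp
  also have "\<dots> = (\<Sum>p\<le>n. (if \<alpha> = lo p \<gamma> then 1 else 0) * (if \<beta> = hi p \<gamma> then 1 else 0))"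
    using u by (intro sum.cong) auto
  finally show ?thesis .
qed

text \<open>Bilinear extension of \<open>lookup_shuffle_sum\<close>: for each p the two Kronecker
  deltas collapse the sums over the supports to single coefficients of x and y.\<close>

lemma lookup_fq_mult:
  fixes x y :: "'k::field fq"
  assumes "x \<in> FQSym m" "y \<in> FQSym m" "\<gamma> \<in> m_perms m n"
  shows "Poly_Mapping.lookup (fq_mult m x y) \<gamma>
    = (\<Sum>p\<le>n. Poly_Mapping.lookup x (lo p \<gamma>) * Poly_Mapping.lookup y (hi p \<gamma>))"
proof -
  let ?d = "\<lambda>a b. if a = b then 1 else 0 :: 'k"
  have "Poly_Mapping.lookup (fq_mult m x y) \<gamma>
      = (\<Sum>\<alpha>\<in>Poly_Mapping.keys x. \<Sum>\<beta>\<in>Poly_Mapping.keys y.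
          Poly_Mapping.lookup x \<alpha> * Poly_Mapping.lookup y \<beta> *
          (\<Sum>\<delta>\<in>shifted_shuffles m \<alpha> \<beta>. Poly_Mapping.lookup (F \<delta>) \<gamma>))"
    by (simp add: fq_mult_def lookup_sum)
  also have "\<dots> = (\<Sum>\<alpha>\<in>Poly_Mapping.keys x. \<Sum>\<beta>\<in>Poly_Mapping.keys y. \<Sum>p\<le>n.
        (Poly_Mapping.lookup x \<alpha> * ?d \<alpha> (lo p \<gamma>)) * (Poly_Mapping.lookup y \<beta> * ?d \<beta> (hi p \<gamma>)))"
  proof (intro sum.cong refl)
    fix \<alpha> \<beta> assume "\<alpha> \<in> Poly_Mapping.keys x" "\<beta> \<in> Poly_Mapping.keys y"
    then obtain p' q' where "\<alpha> \<in> m_perms m p'" "\<beta> \<in> m_perms m q'"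
      using assms unfolding FQSym_def by blast
    from lookup_shuffle_sum[OF this assms(3), where 'k = 'k]
    show "Poly_Mapping.lookup x \<alpha> * Poly_Mapping.lookup y \<beta> *
          (\<Sum>\<delta>\<in>shifted_shuffles m \<alpha> \<beta>. Poly_Mapping.lookup (F \<delta>) \<gamma>)
      = (\<Sum>p\<le>n. (Poly_Mapping.lookup x \<alpha> * ?d \<alpha> (lo p \<gamma>)) *
          (Poly_Mapping.lookup y \<beta> * ?d \<beta> (hi p \<gamma>)))"
      by (simp only: sum_distrib_left mult.assoc mult.left_commute)
  qed
  also have "\<dots> = (\<Sum>\<alpha>\<in>Poly_Mapping.keys x. \<Sum>p\<le>n. \<Sum>\<beta>\<in>Poly_Mapping.keys y.
        (Poly_Mapping.lookup x \<alpha> * ?d \<alpha> (lo p \<gamma>)) * (Poly_Mapping.lookup y \<beta> * ?d \<beta> (hi p \<gamma>)))"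
    by (intro sum.cong refl sum.swap)
  also have "\<dots> = (\<Sum>p\<le>n. \<Sum>\<alpha>\<in>Poly_Mapping.keys x. \<Sum>\<beta>\<in>Poly_Mapping.keys y.
        (Poly_Mapping.lookup x \<alpha> * ?d \<alpha> (lo p \<gamma>)) * (Poly_Mapping.lookup y \<beta> * ?d \<beta> (hi p \<gamma>)))"
    by (rule sum.swap)
  also have "\<dots> = (\<Sum>p\<le>n. lin_ext (*) (\<lambda>\<alpha>. ?d \<alpha> (lo p \<gamma>)) x * lin_ext (*) (\<lambda>\<beta>. ?d \<beta> (hi p \<gamma>)) y)"
    by (simp only: lin_ext_def sum_product)
  finally show ?thesis by (simp only: lin_ext_mult_delta)
qed

lemma fq_mult_in_FQSym:
  fixes x y :: "'k::field fq"
  assumes "x \<in> FQSym m" "y \<in> FQSym m"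
  shows "fq_mult m x y \<in> FQSym m"
  unfolding fq_mult_lin_ext
proof (intro fvs.lin_ext_in_subspace subspace_FQSym fvs.subspace_sum)
  fix \<alpha> \<beta> \<gamma>
  assume "\<alpha> \<in> Poly_Mapping.keys x" "\<beta> \<in> Poly_Mapping.keys y" and \<gamma>: "\<gamma> \<in> shifted_shuffles m \<alpha> \<beta>"
  then obtain p q where "\<alpha> \<in> m_perms m p" "\<beta> \<in> m_perms m q"
    using assms unfolding FQSym_def by blast
  then show "(F \<gamma> :: 'k fq) \<in> FQSym m"
    using \<gamma> by (auto simp: shifted_shuffles_iff intro: F_in_FQSym)
qed

text \<open>At \<gamma>, both sides sum over the ways to divide the letters into three consecutive
  bands; the bracketing only decides which boundary is chosen first.\<close>

lemma fq_mult_assoc: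
  fixes x y z :: "'k::field fq"
  assumes x: "x \<in> FQSym m" and y: "y \<in> FQSym m" and z: "z \<in> FQSym m"
  shows "fq_mult m (fq_mult m x y) z = fq_mult m x (fq_mult m y z)"
proof (rule FQSym_eqI)
  fix n \<gamma> assume \<gamma>: "\<gamma> \<in> m_perms m n"
  let ?f = "\<lambda>p q. Poly_Mapping.lookup x (lo p \<gamma>) *
    (Poly_Mapping.lookup y (lo q (hi p \<gamma>)) * Poly_Mapping.lookup z (hi q (hi p \<gamma>)))"
  have "Poly_Mapping.lookup (fq_mult m (fq_mult m x y) z) \<gamma> = (\<Sum>r\<le>n. \<Sum>p\<le>r. ?f p (r - p))"
    using \<gamma> by (simp add: lookup_fq_mult[OF _ z] lookup_fq_mult[OF x y lo_in_m_perms]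
        fq_mult_in_FQSym x y sum_distrib_right lo_lo hi_lo hi_hi mult.assoc)
  also have "\<dots> = (\<Sum>p\<le>n. \<Sum>q\<le>n - p. ?f p q)"
    by (rule sum_triangle)
  also have "\<dots> = Poly_Mapping.lookup (fq_mult m x (fq_mult m y z)) \<gamma>"
    using \<gamma> by (simp add: lookup_fq_mult[OF x] lookup_fq_mult[OF y z hi_in_m_perms]
        fq_mult_in_FQSym y z sum_distrib_left)
  finally show "Poly_Mapping.lookup (fq_mult m (fq_mult m x y) z) \<gamma>
    = Poly_Mapping.lookup (fq_mult m x (fq_mult m y z)) \<gamma>" .
qed (use assms in \<open>simp_all add: fq_mult_in_FQSym\<close>)

end

section \<open>Standardization and the coproduct in coordinates\<close>

lemma scan_rank_map:
  assumes "strict_mono_on (set w) f" "p < length w"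
  shows "scan_rank (map f w) p = scan_rank w p"
proof -
  have "{q. q < length (map f w) \<and> (map f w ! q < map f w ! p \<or> map f w ! q = map f w ! p \<and> q < p)}
      = {q. q < length w \<and> (w ! q < w ! p \<or> w ! q = w ! p \<and> q < p)}"
    using assms strict_mono_on_less[OF assms(1)] strict_mono_on_eq[OF assms(1)] by auto
  then show ?thesis by (simp only: scan_rank_def)
qed

lemma std_map: "strict_mono_on (set w) f \<Longrightarrow> std m (map f w) = std m w"
  by (simp add: std_def scan_rank_map)

section \<open>Increasing relabellings of the letters\<close>

definition rank_in :: "nat set \<Rightarrow> nat \<Rightarrow> nat" where
  "rank_in I a = card {b \<in> I. b < a} + 1"

text \<open>For j in {1..card I} this is the j-th smallest element of a finite set I; other
  arguments give unspecified values.\<close>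

definition enum_of :: "nat set \<Rightarrow> nat \<Rightarrow> nat" where
  "enum_of I = inv_into I (rank_in I)"

text \<open>Stronger than \<open>m_word\<close>, where higher multiples of m may occur. It is the
  form of those factors of an m-permutation that are m-words, and it makes standardization a
  relabelling of letters.\<close>

definition block_word :: "nat \<Rightarrow> nat list \<Rightarrow> bool" where
  "block_word m w \<longleftrightarrow> (\<forall>a\<in>set w. count_list w a = m)"

lemma strict_mono_on_rank_in:
  assumes "finite I" shows "strict_mono_on I (rank_in I)"
proof (rule strict_mono_onI)
  fix a b assume "a \<in> I" "b \<in> I" "a < b"
  then have "{c \<in> I. c < a} \<subset> {c \<in> I. c < b}" by auto
  then have "card {c \<in> I. c < a} < card {c \<in> I. c < b}"
    using assms by (intro psubset_card_mono) auto
  then show "rank_in I a < rank_in I b" by (simp add: rank_in_def)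
qed

lemma inj_on_rank_in: "finite I \<Longrightarrow> inj_on (rank_in I) I"
  by (rule strict_mono_on_imp_inj_on[OF strict_mono_on_rank_in])

lemma rank_in_image:
  assumes "finite I" shows "rank_in I ` I = {1..card I}"
proof (rule card_subset_eq)
  show "rank_in I ` I \<subseteq> {1..card I}"
  proof clarify
    fix a assume a: "a \<in> I"
    then have "{b \<in> I. b < a} \<subset> I" by auto
    then have "card {b \<in> I. b < a} < card I"
      using assms by (intro psubset_card_mono)
    then show "rank_in I a \<in> {1..card I}" by (simp add: rank_in_def)
  qed
  show "card (rank_in I ` I) = card {1..card I}"
    by (simp add: card_image inj_on_rank_in assms)
qed simp

lemma enum_of_rank_in: "finite I \<Longrightarrow> a \<in> I \<Longrightarrow> enum_of I (rank_in I a) = a"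
  by (simp add: enum_of_def inj_on_rank_in)

lemma rank_in_enum_of: "finite I \<Longrightarrow> j \<in> {1..card I} \<Longrightarrow> rank_in I (enum_of I j) = j"
  using rank_in_image[of I] by (simp add: enum_of_def f_inv_into_f)

lemma enum_of_in: "finite I \<Longrightarrow> j \<in> {1..card I} \<Longrightarrow> enum_of I j \<in> I"
  using rank_in_image[of I] by (simp add: enum_of_def inv_into_into)

lemma rank_in_in: "finite I \<Longrightarrow> a \<in> I \<Longrightarrow> rank_in I a \<in> {1..card I}"
  using rank_in_image[of I] by blast

lemma enum_of_image: "finite I \<Longrightarrow> enum_of I ` {1..card I} = I"
proof (intro equalityI subsetI)
  fix a assume "finite I" "a \<in> I"
  then show "a \<in> enum_of I ` {1..card I}"
    by (metis rank_in_in enum_of_rank_in imageI)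
qed (blast dest: enum_of_in)

lemma strict_mono_on_enum_of:
  assumes "finite I" shows "strict_mono_on {1..card I} (enum_of I)"
proof (rule strict_mono_onI)
  fix a b assume ab: "a \<in> {1..card I}" "b \<in> {1..card I}" "a < b"
  then have "rank_in I (enum_of I a) < rank_in I (enum_of I b)"
    using assms by (simp only: rank_in_enum_of)
  then show "enum_of I a < enum_of I b"
    using strict_mono_on_less[OF strict_mono_on_rank_in[OF assms]] ab assms enum_of_in by blast
qed

lemma inj_on_enum_of: "finite I \<Longrightarrow> inj_on (enum_of I) {1..card I}"
  by (rule strict_mono_on_imp_inj_on[OF strict_mono_on_enum_of])

text \<open>Neighbouring letters that both lie in I receive neighbouring ranks, so their entry in
  the descent word is an entry for the relabelled word as well.\<close>

lemma rank_in_Suc: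
  assumes "finite I" "i \<in> I" shows "rank_in I (i + 1) = rank_in I i + 1"
proof -
  have "{b \<in> I. b < i + 1} = insert i {b \<in> I. b < i}" using assms by auto
  then show ?thesis using assms by (simp add: rank_in_def)
qed

text \<open>
  A letter of a block word fills exactly one batch of m scanned positions, so standardization
  replaces it by its rank among the letters that occur.
\<close>

lemma std_block_word:
  assumes "block_word m w" shows "std m w = map (rank_in (set w)) w"
proof -
  have "scan_rank w p div m + 1 = rank_in (set w) (w ! p)" if p: "p < length w" for p
  proof -
    let ?a = "w ! p"
    let ?L = "{q. q < length w \<and> w ! q < ?a}" and ?E = "{q. q < p \<and> w ! q = ?a}"
    have cnt: "count_list w ?a = m" using assms p by (simp add: block_word_def)
    have "{q. q < length w \<and> (w ! q < ?a \<or> w ! q = ?a \<and> q < p)} = ?L \<union> ?E"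
      using p by auto
    then have "scan_rank w p = card (?L \<union> ?E)"
      by (simp only: scan_rank_def)
    also have "\<dots> = card ?L + card ?E"
      by (rule card_Un_disjoint) auto
    finally have s: "scan_rank w p = card ?L + card ?E" .
    have "card ?L = length (filter (\<lambda>x. x < ?a) w)"
      by (simp add: length_filter_conv_card)
    also have "\<dots> = (\<Sum>b\<in>{b \<in> set w. b < ?a}. count_list (filter (\<lambda>x. x < ?a) w) b)"
      by (rule sum_count_set[symmetric]) auto
    also have "\<dots> = (\<Sum>b\<in>{b \<in> set w. b < ?a}. m)"
    proof (rule sum.cong[OF refl])
      fix b assume "b \<in> {b \<in> set w. b < ?a}"
      then show "count_list (filter (\<lambda>x. x < ?a) w) b = m"
        using assms unfolding block_word_def count_list_filter by simp
    qed
    finally have L: "card ?L = m * card {b \<in> set w. b < ?a}" by simp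
    have "?E \<subset> {q. q < length w \<and> ?a = w ! q}" using p by auto
    then have "card ?E < card {q. q < length w \<and> ?a = w ! q}"
      by (intro psubset_card_mono) auto
    also have "\<dots> = m"
      using cnt by (simp add: count_list_eq_length_filter length_filter_conv_card)
    finally have "card ?E < m" .
    then have "scan_rank w p div m = card {b \<in> set w. b < ?a}"
      unfolding s L by simp
    then show ?thesis by (simp only: rank_in_def)
  qed
  then show ?thesis by (intro nth_equalityI) (auto simp: std_def)
qed

lemma std_Nil [simp]: "std m [] = []"
  by (simp add: std_def)

lemma std_eq_Nil_iff [simp]: "std m w = [] \<longleftrightarrow> w = []"
  by (simp add: std_def)

lemma append_eq_image: "{(u, v). u @ v = \<alpha>} = (\<lambda>k. (take k \<alpha>, drop k \<alpha>)) ` {..length \<alpha>}"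
proof (intro equalityI subsetI)
  fix z assume "z \<in> {(u, v). u @ v = \<alpha>}"
  then obtain u v where "z = (u, v)" "u @ v = \<alpha>" by auto
  then have "z = (take (length u) \<alpha>, drop (length u) \<alpha>)" "length u \<in> {..length \<alpha>}" by auto
  then show "z \<in> (\<lambda>k. (take k \<alpha>, drop k \<alpha>)) ` {..length \<alpha>}" by blast
qed auto

lemma finite_append_eq [simp]: "finite {(u, v). u @ v = \<alpha> \<and> Q u v}"
proof (rule finite_subset)
  show "finite {(u, v). u @ v = \<alpha>}" by (simp add: append_eq_image)
qed auto

context
  fixes m :: nat
  assumes m_pos: "m \<ge> 1"
begin

lemma block_word_m_perms: "a \<in> m_perms m p \<Longrightarrow> block_word m a"
  by (auto simp: block_word_def m_perms_def)

lemma map_rank_in_m_perms: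
  assumes "block_word m w" shows "map (rank_in (set w)) w \<in> m_perms m (card (set w))"
proof -
  have "count_list (map (rank_in (set w)) w) i = m" if "i \<in> {1..card (set w)}" for i
  proof -
    from that obtain a where a: "a \<in> set w" "i = rank_in (set w) a"
      using rank_in_image[of "set w"] by (metis List.finite_set imageE)
    have "count_list (map (rank_in (set w)) w) (rank_in (set w) a) = count_list w a"
      by (rule count_list_map_inj_on) (simp add: insert_absorb a inj_on_rank_in)
    then show ?thesis using a assms by (simp add: block_word_def)
  qed
  then show ?thesis using rank_in_image[of "set w"] by (simp add: m_perms_def)
qed

lemma std_in_m_perms: "block_word m w \<Longrightarrow> std m w \<in> m_perms m (card (set w))"
  by (simp add: std_block_word map_rank_in_m_perms)

lemma map_enum_of_std: "block_word m w \<Longrightarrow> map (enum_of (set w)) (std m w) = w"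
  by (auto simp: std_block_word enum_of_rank_in intro: map_idI)

text \<open>Together with \<open>map_enum_of_std\<close>: a block word amounts to an m-permutation
  and a finite set of letters of matching size, standardization forgetting the set.\<close>

lemma map_enum_of_m_perms:
  assumes "a \<in> m_perms m p" "finite I" "card I = p"
  shows "set (map (enum_of I) a) = I"
    and "std m (map (enum_of I) a) = a"
    and "i \<in> I \<Longrightarrow> count_list (map (enum_of I) a) i = m"
proof -
  have set: "set a = {1..card I}" using set_m_perms[OF m_pos assms(1)] assms(3) by simp
  show 1: "set (map (enum_of I) a) = I"
    using enum_of_image[OF assms(2)] unfolding set_map set .
  have "std m (map (enum_of I) a) = std m a"
    by (rule std_map) (unfold set, rule strict_mono_on_enum_of[OF assms(2)])
  also have "\<dots> = map (rank_in {1..card I}) a"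
    using block_word_m_perms[OF assms(1)] set by (simp add: std_block_word)
  also have "\<dots> = a"
  proof (rule map_idI)
    fix j assume "j \<in> set a"
    then have "{b \<in> {1..card I}. b < j} = {1..<j}" "j \<ge> 1" using set by auto
    then show "rank_in {1..card I} j = j" by (simp add: rank_in_def)
  qed
  finally show "std m (map (enum_of I) a) = a" .
  assume i: "i \<in> I"
  have "count_list (map (enum_of I) a) (enum_of I (rank_in I i)) = count_list a (rank_in I i)"
    using set rank_in_in[OF assms(2) i] inj_on_enum_of[OF assms(2)]
    by (intro count_list_map_inj_on) (simp add: insert_absorb)
  then show "count_list (map (enum_of I) a) i = m"
    using assms i rank_in_in[OF assms(2) i] by (simp add: enum_of_rank_in m_perms_def)
qed

lemma before_last_map_enum_of:
  assumes "a \<in> m_perms m p" "finite I" "card I = p" "i \<in> I" "i + 1 \<in> I"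
  shows "before_last (map (enum_of I) a) i (i + 1)
    = before_last a (rank_in I i) (rank_in I i + 1)"
proof -
  have "before_last (map (enum_of I) a) (enum_of I (rank_in I i)) (enum_of I (rank_in I (i + 1)))
      = before_last a (rank_in I i) (rank_in I (i + 1))"
    using set_m_perms[OF m_pos assms(1)] rank_in_in[OF assms(2,4)] rank_in_in[OF assms(2,5)]
      inj_on_enum_of[OF assms(2)] assms(3)
    by (intro before_last_map) (simp add: insert_absorb)
  then show ?thesis
    unfolding enum_of_rank_in[OF assms(2,4)] enum_of_rank_in[OF assms(2,5)]
    unfolding rank_in_Suc[OF assms(2,4)] .
qed

lemma merge_in_m_perms:
  assumes a: "a \<in> m_perms m p" "finite I" "card I = p"
    and b: "b \<in> m_perms m q" "finite J" "card J = q"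
    and IJ: "I \<inter> J = {}" "I \<union> J = {1..n}"
  shows "map (enum_of I) a @ map (enum_of J) b \<in> m_perms m n"
proof -
  have "count_list (map (enum_of I) a @ map (enum_of J) b) i = m" if "i \<in> {1..n}" for i
  proof (cases "i \<in> I")
    case True
    then have "i \<notin> set (map (enum_of J) b)" using map_enum_of_m_perms(1)[OF b] IJ by blast
    then have "count_list (map (enum_of J) b) i = 0" by (simp only: count_list_0_iff not_False_eq_True)
    then show ?thesis
      using map_enum_of_m_perms(3)[OF a True] by (simp only: count_list_append add_0_right)
  next
    case False
    then have "i \<notin> set (map (enum_of I) a)" "i \<in> J"
      using map_enum_of_m_perms(1)[OF a] IJ that by blast+
    then have "count_list (map (enum_of I) a) i = 0" by (simp only: count_list_0_iff not_False_eq_True)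
    then show ?thesis
      using map_enum_of_m_perms(3)[OF b \<open>i \<in> J\<close>] by (simp only: count_list_append add_0_left)
  qed
  moreover have "set (map (enum_of I) a @ map (enum_of J) b) = {1..n}"
    using map_enum_of_m_perms(1)[OF a] map_enum_of_m_perms(1)[OF b] IJ by (simp only: set_append)
  ultimately show ?thesis by (simp add: m_perms_def)
qed

text \<open>If i lies in J, all letters i + 1 of the left word are counted, and their number, m or
  0, is fixed by I. If i lies in I, the right word is never counted. What remains is an entry inside
  a single factor, taken from its own descent word, or 0.\<close>

lemma GD_merge_cong:
  assumes a: "a \<in> m_perms m p" "a' \<in> m_perms m p" "GD p a = GD p a'" "finite I" "card I = p"
    and b: "b \<in> m_perms m q" "b' \<in> m_perms m q" "GD q b = GD q b'" "finite J" "card J = q"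
    and IJ: "I \<inter> J = {}" "I \<union> J = {1..n}"
  shows "GD n (map (enum_of I) a @ map (enum_of J) b)
       = GD n (map (enum_of I) a' @ map (enum_of J) b')"
proof -
  let ?u = "map (enum_of I)" and ?v = "map (enum_of J)"
  note u = map_enum_of_m_perms[OF a(1,4,5)] map_enum_of_m_perms[OF a(2,4,5)]
  note v = map_enum_of_m_perms[OF b(1,4,5)] map_enum_of_m_perms[OF b(2,4,5)]
  \<comment> \<open>Stated for a generic set K because it is used for I and for J. As i + 1 has the
    next rank, the rank of i is below r and thus indexes an entry of the descent word.\<close>
  have GD_D: "before_last c (rank_in K i) (rank_in K i + 1) = before_last d (rank_in K i) (rank_in K i + 1)"
    if "c \<in> m_perms m r" "d \<in> m_perms m r" "GD r c = GD r d" "finite K" "card K = r"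
      "i \<in> K" "i + 1 \<in> K" for c d r K i
  proof (rule GD_eqD[OF m_pos that(1-3)])
    show "rank_in K i \<in> {1..<r}"
      using rank_in_in[OF that(4,6)] rank_in_in[OF that(4,7)]
      unfolding rank_in_Suc[OF that(4,6)] that(5) by simp
  qed
  have "before_last (?u a @ ?v b) i (i + 1) = before_last (?u a' @ ?v b') i (i + 1)"
    if i: "i \<in> {1..<n}" for i
  proof -
    have mem: "i \<in> I \<and> i \<notin> J \<or> i \<in> J \<and> i \<notin> I" "i + 1 \<in> I \<and> i + 1 \<notin> J \<or> i + 1 \<in> J \<and> i + 1 \<notin> I"
      using i IJ by (auto simp: set_eq_iff)
    have cnt: "count_list (?u a) (i + 1) = count_list (?u a') (i + 1)"
    proof (cases "i + 1 \<in> I")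
      case False
      then have "count_list (?u a) (i + 1) = 0" "count_list (?u a') (i + 1) = 0"
        unfolding count_list_0_iff u(1,4) by auto
      then show ?thesis by simp
    qed (use u(3,6) in simp)
    show ?thesis
    proof (cases "i \<in> J")
      case True
      have "before_last (?v b) i (i + 1) = before_last (?v b') i (i + 1)"
      proof (cases "i + 1 \<in> J")
        case T: True
        show ?thesis
          unfolding before_last_map_enum_of[OF b(1,4,5) True T]
            before_last_map_enum_of[OF b(2,4,5) True T]
          by (rule GD_D[OF b True T])
      next
        case False
        then show ?thesis using v by (simp add: before_last_notin_right del: set_map)
      qed
      then show ?thesis using True v cnt by (simp add: before_last_append del: set_map)
    next
      case False
      have "before_last (?u a) i (i + 1) = before_last (?u a') i (i + 1)"
      proof (cases "i + 1 \<in> I")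
        case T: True
        have I: "i \<in> I" using mem False by blast
        show ?thesis
          unfolding before_last_map_enum_of[OF a(1,4,5) I T]
            before_last_map_enum_of[OF a(2,4,5) I T]
          by (rule GD_D[OF a I T])
      next
        case F: False
        then show ?thesis using u by (simp add: before_last_notin_right del: set_map)
      qed
      then show ?thesis using False v by (simp add: before_last_append del: set_map)
    qed
  qed
  then show ?thesis
    using merge_in_m_perms[OF a(1,4,5) b(1,4,5) IJ] merge_in_m_perms[OF a(2,4,5) b(2,4,5) IJ]
    by (simp add: GD_before_last[OF m_pos])
qed

text \<open>The multiplicities of a letter in u and in v are multiples of m with sum m, so one of
  them is 0 and the letter lies entirely in one factor.\<close>

lemma split_m_perm:
  assumes "u @ v \<in> m_perms m n" "m_word m u" "m_word m v"
  shows "block_word m u" "block_word m v" "set u \<inter> set v = {}" "set u \<union> set v = {1..n}"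
proof -
  have set: "set (u @ v) = {1..n}" by (rule set_m_perms[OF m_pos assms(1)])
  then show "set u \<union> set v = {1..n}" by simp
  have eq: "count_list u i + count_list v i = m" if "i \<in> set u \<union> set v" for i
    using assms(1) set that by (simp add: m_perms_def)
  have full: "count_list u i = 0 \<or> count_list u i = m" "count_list v i = 0 \<or> count_list v i = m"
    if "i \<in> set u \<union> set v" for i
  proof -
    have *: "k = 0 \<or> k = m" if "m dvd k" "k \<le> m" for k
      using that by (metis dvd_imp_le le_antisym not_gr0)
    show "count_list u i = 0 \<or> count_list u i = m"
      by (rule *) (use eq[OF that] assms(2) in \<open>auto simp: m_word_def\<close>)
    show "count_list v i = 0 \<or> count_list v i = m"
      by (rule *) (use eq[OF that] assms(3) in \<open>auto simp: m_word_def\<close>)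
  qed
  then show "block_word m u" "block_word m v"
    unfolding block_word_def by (metis UnCI count_list_0_iff)+
  show "set u \<inter> set v = {}"
  proof (intro equals0I)
    fix i assume "i \<in> set u \<inter> set v"
    then have "count_list u i = m" "count_list v i = m"
      using full[of i] by (auto simp: count_list_0_iff)
    then show False using eq[of i] m_pos \<open>i \<in> set u \<inter> set v\<close> by auto
  qed
qed

section \<open>Coefficients of the coproduct\<close>

definition splittings :: "nat \<Rightarrow> nat list \<Rightarrow> nat list \<Rightarrow> (nat list \<times> nat list) set" where
  "splittings n a b = {(u, v). u @ v \<in> m_perms m n \<and> m_word m u \<and> m_word m v \<and>
     std m u = a \<and> std m v = b}"

lemma finite_splittings: "finite (splittings n a b)"
proof -
  have "splittings n a b \<subseteq> (\<Union>\<alpha>\<in>m_perms m n. {(u, v). u @ v = \<alpha> \<and> True})"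
    by (auto simp: splittings_def)
  then show ?thesis
    by (rule finite_subset) (intro finite_UN_I finite_m_perms finite_append_eq)
qed

lemma lookup_fq_comult_splittings:
  fixes x :: "'k::field fq"
  assumes "Poly_Mapping.keys x \<subseteq> m_perms m n"
  shows "Poly_Mapping.lookup (fq_comult m x) (a, b)
    = (\<Sum>(u, v)\<in>splittings n a b. Poly_Mapping.lookup x (u @ v))"
proof -
  have "fq_comult m x = (\<Sum>\<alpha>\<in>m_perms m n. fscale (Poly_Mapping.lookup x \<alpha>)
      (\<Sum>(u, v) | u @ v = \<alpha> \<and> m_word m u \<and> m_word m v. tens (F (std m u)) (F (std m v))))"
    unfolding fq_comult_lin_ext using assms by (intro fvs.lin_ext_superset) auto
  then have "Poly_Mapping.lookup (fq_comult m x) (a, b) = (\<Sum>\<alpha>\<in>m_perms m n. \<Sum>(u, v) | u @ v = \<alpha> \<and>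
      m_word m u \<and> m_word m v. if std m u = a \<and> std m v = b then Poly_Mapping.lookup x \<alpha> else 0)"
    by (simp add: lookup_sum tens_F case_prod_unfold lookup_single when_def sum_distrib_left
        if_distrib cong: if_cong)
  also have "\<dots> = (\<Sum>\<alpha>\<in>m_perms m n. \<Sum>(u, v) | (u, v) \<in> splittings n a b \<and> u @ v = \<alpha>.
      Poly_Mapping.lookup x (u @ v))"
  proof (rule sum.cong[OF refl])
    fix \<alpha> assume \<alpha>: "\<alpha> \<in> m_perms m n"
    show "(\<Sum>(u, v) | u @ v = \<alpha> \<and> m_word m u \<and> m_word m v.
        if std m u = a \<and> std m v = b then Poly_Mapping.lookup x \<alpha> else 0)
      = (\<Sum>(u, v) | (u, v) \<in> splittings n a b \<and> u @ v = \<alpha>. Poly_Mapping.lookup x (u @ v))"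
      by (rule sum.mono_neutral_cong_right) (use \<alpha> in \<open>auto simp: splittings_def split: if_splits\<close>)
  qed
  also have "\<dots> = (\<Sum>(u, v)\<in>splittings n a b. Poly_Mapping.lookup x (u @ v))"
    using sum.group[of "splittings n a b" "m_perms m n" "\<lambda>(u, v). u @ v"
        "\<lambda>(u, v). Poly_Mapping.lookup x (u @ v)"] finite_splittings
    by (auto simp: case_prod_unfold splittings_def)
  finally show ?thesis .
qed

lemma splittings_degrees:
  assumes "(u, v) \<in> splittings n a b"
  obtains p q where "p + q = n" "a \<in> m_perms m p" "b \<in> m_perms m q"
proof
  from assms have *: "u @ v \<in> m_perms m n" "m_word m u" "m_word m v" "std m u = a" "std m v = b"
    by (auto simp: splittings_def)
  note s = split_m_perm[OF *(1-3)]
  show "a \<in> m_perms m (card (set u))" "b \<in> m_perms m (card (set v))"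
    using s std_in_m_perms *(4,5) by blast+
  show "card (set u) + card (set v) = n"
    using card_Un_disjoint[of "set u" "set v"] s by simp
qed

lemma m_word_map_enum_of:
  assumes "a \<in> m_perms m p" "finite I" "card I = p" shows "m_word m (map (enum_of I) a)"
  unfolding m_word_def
proof
  fix i show "m dvd count_list (map (enum_of I) a) i"
    using map_enum_of_m_perms[OF assms] by (cases "i \<in> I") (auto simp: count_notin simp del: set_map)
qed

text \<open>A factorization is recovered from the letter set of its left factor: the right factor
  uses the complement, and each factor is the increasing relabelling of its standardization.\<close>

lemma bij_betw_splittings:
  assumes a: "a \<in> m_perms m p" and b: "b \<in> m_perms m q" and n: "p + q = n"
  shows "bij_betw (\<lambda>I. (map (enum_of I) a, map (enum_of ({1..n} - I)) b))
    {I. I \<subseteq> {1..n} \<and> card I = p} (splittings n a b)"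
proof (rule bij_betw_byWitness[where f' = "\<lambda>(u, v). set u"])
  have J: "finite I \<and> finite ({1..n} - I) \<and> card ({1..n} - I) = q" if "I \<subseteq> {1..n}" "card I = p" for I
    using that n by (auto simp: card_Diff_subset finite_subset)
  show "\<forall>I\<in>{I. I \<subseteq> {1..n} \<and> card I = p}.
      (\<lambda>(u, v). set u) (map (enum_of I) a, map (enum_of ({1..n} - I)) b) = I"
    using map_enum_of_m_perms(1)[OF a] J by (auto simp del: set_map)
  show "(\<lambda>I. (map (enum_of I) a, map (enum_of ({1..n} - I)) b)) ` {I. I \<subseteq> {1..n} \<and> card I = p}
      \<subseteq> splittings n a b"
  proof clarify
    fix I assume I: "I \<subseteq> {1..n}" "p = card I"
    note JI = J[OF I(1) I(2)[symmetric]]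
    have "map (enum_of I) a @ map (enum_of ({1..n} - I)) b \<in> m_perms m n"
      by (rule merge_in_m_perms[OF a _ I(2)[symmetric] b]) (use JI I in auto)
    then show "(map (enum_of I) a, map (enum_of ({1..n} - I)) b) \<in> splittings n a b"
      using JI I(2)[symmetric] map_enum_of_m_perms(2)[OF a] map_enum_of_m_perms(2)[OF b]
        m_word_map_enum_of[OF a] m_word_map_enum_of[OF b]
      by (simp add: splittings_def)
  qed
  have uv: "map (enum_of (set u)) a = u" "map (enum_of ({1..n} - set u)) b = v"
      "set u \<subseteq> {1..n}" "card (set u) = p"
    if "(u, v) \<in> splittings n a b" for u v
  proof -
    from that have *: "u @ v \<in> m_perms m n" "m_word m u" "m_word m v" "std m u = a" "std m v = b"
      by (auto simp: splittings_def)
    note s = split_m_perm[OF *(1-3)]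
    show "map (enum_of (set u)) a = u"
      using map_enum_of_std[OF s(1)] *(4) by simp
    have "{1..n} - set u = set v" using s(3,4) by blast
    then show "map (enum_of ({1..n} - set u)) b = v"
      using map_enum_of_std[OF s(2)] *(5) by simp
    show "set u \<subseteq> {1..n}" using s(4) by blast
    show "card (set u) = p"
      using std_in_m_perms[OF s(1)] *(4) a m_perms_unique[OF m_pos] by blast
  qed
  then show "\<forall>x\<in>splittings n a b. (\<lambda>I. (map (enum_of I) a, map (enum_of ({1..n} - I)) b))
      ((\<lambda>(u, v). set u) x) = x"
    by (auto simp del: set_map)
  show "(\<lambda>(u, v). set u) ` splittings n a b \<subseteq> {I. I \<subseteq> {1..n} \<and> card I = p}"
    using uv(3,4) by auto
qed

lemma lookup_fq_comult:
  fixes x :: "'k::field fq"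
  assumes "Poly_Mapping.keys x \<subseteq> m_perms m n" "a \<in> m_perms m p" "b \<in> m_perms m q" "p + q = n"
  shows "Poly_Mapping.lookup (fq_comult m x) (a, b) = (\<Sum>I | I \<subseteq> {1..n} \<and> card I = p.
    Poly_Mapping.lookup x (map (enum_of I) a @ map (enum_of ({1..n} - I)) b))"
  unfolding lookup_fq_comult_splittings[OF assms(1)]
  by (simp flip: sum.reindex_bij_betw[OF bij_betw_splittings[OF assms(2-4)]])

end

section \<open>Elements whose coefficients depend only on the descent word\<close>

text \<open>The explicit form of the hull \<open>NCSF m\<close>, as \<open>NCSF_eq\<close> shows.
  Degrees 0 and 1 both have the empty descent word, but words of different degree are not
  compared.\<close>

definition gd_invariant :: "nat \<Rightarrow> 'k::field fq set" where
  "gd_invariant m = {x \<in> FQSym m. \<forall>n. \<forall>\<sigma>\<in>m_perms m n. \<forall>\<tau>\<in>m_perms m n.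
     GD n \<sigma> = GD n \<tau> \<longrightarrow> Poly_Mapping.lookup x \<sigma> = Poly_Mapping.lookup x \<tau>}"

definition gd_homog :: "nat \<Rightarrow> nat \<Rightarrow> 'k::field fq set" where
  "gd_homog m n = {x \<in> gd_invariant m. Poly_Mapping.keys x \<subseteq> m_perms m n}"

text \<open>The degree is explicit, unlike in \<open>R\<close>, so that the class in degree 0 is
  covered too; its sum is the unit.\<close>

definition gd_sum :: "nat \<Rightarrow> nat \<Rightarrow> nat list \<Rightarrow> 'k::field fq" where
  "gd_sum m n w = (\<Sum>\<sigma> | \<sigma> \<in> m_perms m n \<and> GD n \<sigma> = w. F \<sigma>)"

lemma R_gd_sum: "R m w = gd_sum m (length w + 1) w"
  by (simp add: R_def gd_sum_def)

lemma lookup_gd_sum: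
  "Poly_Mapping.lookup (gd_sum m n w) \<sigma> = (if \<sigma> \<in> m_perms m n \<and> GD n \<sigma> = w then 1 else 0)"
  by (simp add: gd_sum_def lookup_sum lookup_F)

lemma keys_gd_sum: "Poly_Mapping.keys (gd_sum m n w) \<subseteq> m_perms m n"
  by (auto simp: in_keys_iff lookup_gd_sum split: if_splits)

lemma gd_invariantI:
  assumes "x \<in> FQSym m"
    and "\<And>n \<sigma> \<tau>. \<sigma> \<in> m_perms m n \<Longrightarrow> \<tau> \<in> m_perms m n \<Longrightarrow> GD n \<sigma> = GD n \<tau> \<Longrightarrow>
      Poly_Mapping.lookup x \<sigma> = Poly_Mapping.lookup x \<tau>"
  shows "x \<in> gd_invariant m"
  unfolding gd_invariant_def
  by (intro CollectI conjI allI ballI impI; (rule assms(1) | rule assms(2))) assumption+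

lemma gd_invariantD:
  "x \<in> gd_invariant m \<Longrightarrow> \<sigma> \<in> m_perms m n \<Longrightarrow> \<tau> \<in> m_perms m n \<Longrightarrow> GD n \<sigma> = GD n \<tau> \<Longrightarrow>
    Poly_Mapping.lookup x \<sigma> = Poly_Mapping.lookup x \<tau>"
  unfolding gd_invariant_def by blast

lemma gd_invariant_FQSym: "x \<in> gd_invariant m \<Longrightarrow> x \<in> FQSym m"
  by (simp add: gd_invariant_def)

lemma subspace_gd_invariant: "fvs.subspace (gd_invariant m :: 'k::field fq set)"
proof (rule fvs.subspaceI)
  note FQSym = subspace_FQSym[of m, where 'k = 'k]
  show "0 \<in> (gd_invariant m :: 'k fq set)"
    by (rule gd_invariantI) (simp_all add: fvs.subspace_0 FQSym)
  fix x y :: "'k fq" and c :: 'k assume x: "x \<in> gd_invariant m" and y: "y \<in> gd_invariant m"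
  have eqs: "Poly_Mapping.lookup x \<sigma> = Poly_Mapping.lookup x \<tau>"
      "Poly_Mapping.lookup y \<sigma> = Poly_Mapping.lookup y \<tau>"
    if "\<sigma> \<in> m_perms m n" "\<tau> \<in> m_perms m n" "GD n \<sigma> = GD n \<tau>" for n \<sigma> \<tau>
    by (rule gd_invariantD[OF x that], rule gd_invariantD[OF y that])
  show "x + y \<in> gd_invariant m"
  proof (rule gd_invariantI)
    show "x + y \<in> FQSym m" by (intro fvs.subspace_add FQSym gd_invariant_FQSym x y)
  qed (unfold lookup_add, metis eqs)
  show "fscale c x \<in> gd_invariant m"
  proof (rule gd_invariantI)
    show "fscale c x \<in> FQSym m" by (intro fvs.subspace_scale FQSym gd_invariant_FQSym x)
  qed (unfold lookup_fscale, metis eqs(1))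
qed

lemma tens_sum_F:
  assumes "finite A" "finite B"
  shows "tens (\<Sum>a\<in>A. F a) (\<Sum>b\<in>B. F b) = (\<Sum>z\<in>A \<times> B. Poly_Mapping.single z 1)"
proof (rule poly_mapping_eqI)
  fix z :: "nat list \<times> nat list"
  obtain a b where z: "z = (a, b)" by fastforce
  show "Poly_Mapping.lookup (tens (\<Sum>a\<in>A. F a) (\<Sum>b\<in>B. F b)) z
    = Poly_Mapping.lookup (\<Sum>z\<in>A \<times> B. Poly_Mapping.single z 1) z"
    using assms unfolding z lookup_tens
    by (simp add: lookup_sum lookup_F lookup_single when_def)
qed

text \<open>The letter at position \<open>length w\<close> is exactly the one that the prefix and
  the suffix both skip.\<close>

lemma words_eq_split_iff:
  assumes "length g = length w + length w' + 1"
  shows "take (length w) g = w \<and> drop (length w + 1) g = w' \<longleftrightarrow> g = w @ [g ! length w] @ w'"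
proof
  assume "take (length w) g = w \<and> drop (length w + 1) g = w'"
  moreover have "g = take (length w) g @ [g ! length w] @ drop (length w + 1) g"
    using assms id_take_nth_drop[of "length w" g] by simp
  ultimately show "g = w @ [g ! length w] @ w'" by metis
next
  assume "g = w @ [g ! length w] @ w'"
  then obtain c where "g = w @ [c] @ w'" by blast
  then show "take (length w) g = w \<and> drop (length w + 1) g = w'" by simp
qed

context
  fixes m :: nat
  assumes m_pos: "m \<ge> 1"
begin

lemma gd_sum_0: "gd_sum m 0 [] = fq_one"
proof -
  have "{\<sigma>. \<sigma> \<in> m_perms m 0 \<and> GD 0 \<sigma> = []} = {[]}" by (auto simp: m_perms_0 GD_def)
  then show ?thesis by (simp only: gd_sum_def fq_one_def) simp
qed

lemma gd_sum_in_gd_homog: "(gd_sum m n w :: 'k::field fq) \<in> gd_homog m n"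
proof -
  let ?x = "gd_sum m n w :: 'k fq"
  have "?x \<in> gd_invariant m"
  proof (rule gd_invariantI)
    show "?x \<in> FQSym m"
      using keys_gd_sum[of m n w, where 'a = 'k] unfolding FQSym_def by auto
    fix n' \<sigma> \<tau> assume *: "\<sigma> \<in> m_perms m n'" "\<tau> \<in> m_perms m n'" "GD n' \<sigma> = GD n' \<tau>"
    have "\<sigma> \<in> m_perms m n \<longleftrightarrow> n' = n" "\<tau> \<in> m_perms m n \<longleftrightarrow> n' = n"
      using *(1,2) m_perms_unique[OF m_pos *(1), of n] m_perms_unique[OF m_pos *(2), of n]
      by auto
    then show "Poly_Mapping.lookup ?x \<sigma> = Poly_Mapping.lookup ?x \<tau>"
      using *(3) unfolding lookup_gd_sum by auto
  qed
  then show ?thesis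
    using keys_gd_sum[of m n w, where 'a = 'k] by (simp add: gd_homog_def)
qed

lemma fq_one_in_gd_invariant: "(fq_one :: 'k::field fq) \<in> gd_invariant m"
  using gd_sum_in_gd_homog[of 0 "[]", where 'k = 'k] by (simp add: gd_sum_0 gd_homog_def)

lemma R_in_gd_invariant: "(R m w :: 'k::field fq) \<in> gd_invariant m"
  using gd_sum_in_gd_homog[of "length w + 1" w, where 'k = 'k]
  by (simp add: R_gd_sum gd_homog_def)

lemma fq_mult_in_gd_invariant:
  fixes x y :: "'k::field fq"
  assumes x: "x \<in> gd_invariant m" and y: "y \<in> gd_invariant m"
  shows "fq_mult m x y \<in> gd_invariant m"
proof -
  have xy: "x \<in> FQSym m" "y \<in> FQSym m" using x y by (auto dest: gd_invariant_FQSym)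
  show ?thesis
  proof (rule gd_invariantI[OF fq_mult_in_FQSym[OF m_pos xy]])
    fix n \<sigma> \<tau> assume \<sigma>: "\<sigma> \<in> m_perms m n" and \<tau>: "\<tau> \<in> m_perms m n" and eq: "GD n \<sigma> = GD n \<tau>"
    show "Poly_Mapping.lookup (fq_mult m x y) \<sigma> = Poly_Mapping.lookup (fq_mult m x y) \<tau>"
    unfolding lookup_fq_mult[OF m_pos xy \<sigma>] lookup_fq_mult[OF m_pos xy \<tau>]
  proof (rule sum.cong[OF refl])
    fix p assume "p \<in> {..n}"
    then have p: "p \<le> n" by simp
    have "Poly_Mapping.lookup x (lo p \<sigma>) = Poly_Mapping.lookup x (lo p \<tau>)"
      by (rule gd_invariantD[OF x lo_in_m_perms[OF \<sigma> p] lo_in_m_perms[OF \<tau> p]])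
        (simp add: GD_lo[OF m_pos \<sigma> p] GD_lo[OF m_pos \<tau> p] eq)
    moreover have "Poly_Mapping.lookup y (hi p \<sigma>) = Poly_Mapping.lookup y (hi p \<tau>)"
      by (rule gd_invariantD[OF y hi_in_m_perms[OF m_pos \<sigma> p] hi_in_m_perms[OF m_pos \<tau> p]])
        (simp add: GD_hi[OF m_pos \<sigma> p] GD_hi[OF m_pos \<tau> p] eq)
    ultimately show "Poly_Mapping.lookup x (lo p \<sigma>) * Poly_Mapping.lookup y (hi p \<sigma>)
      = Poly_Mapping.lookup x (lo p \<tau>) * Poly_Mapping.lookup y (hi p \<tau>)" by simp
  qed
  qed
qed

lemma subalgebra_gd_invariant: "subalgebra m (gd_invariant m)"
  unfolding subalgebra_def
  by (intro conjI ballI subsetI subspace_gd_invariant fq_one_in_gd_invariant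
      fq_mult_in_gd_invariant gd_invariant_FQSym)

lemma gd_invariant_span:
  fixes x :: "'k::field fq"
  assumes x: "x \<in> gd_invariant m"
  shows "x \<in> fvs.span (insert fq_one (R m ` A_words m))"
proof -
  define d where "d = (\<lambda>\<sigma> :: nat list. length \<sigma> div m)"
  \<comment> \<open>The degree is part of the label because the descent word is empty in degree 0
    and in degree 1 alike.\<close>
  define h where "h = (\<lambda>\<sigma>. (d \<sigma>, GD (d \<sigma>) \<sigma>))"
  \<comment> \<open>All m-permutations of the degrees occurring in x: a finite set that contains
    every class it meets.\<close>
  define Z where "Z = (\<Union>n\<in>d ` Poly_Mapping.keys x. m_perms m n)"
  have d: "d \<sigma> = n" if "\<sigma> \<in> m_perms m n" for \<sigma> n
    using m_perms_degree[OF m_pos that] by (simp add: d_def)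
  have Z: "\<sigma> \<in> m_perms m (d \<sigma>) \<and> d \<sigma> \<in> d ` Poly_Mapping.keys x \<longleftrightarrow> \<sigma> \<in> Z" for \<sigma>
    unfolding Z_def UN_iff using d by metis
  have "x \<in> fvs.span ((\<lambda>y. \<Sum>z | z \<in> Z \<and> h z = h y. Poly_Mapping.single z (1::'k)) ` Z)"
  proof (rule fibre_const_in_span)
    show "finite Z" by (auto simp: Z_def)
    show "Poly_Mapping.keys x \<subseteq> Z"
    proof
      fix \<sigma> assume "\<sigma> \<in> Poly_Mapping.keys x"
      moreover from this obtain n where "\<sigma> \<in> m_perms m n"
        using x unfolding gd_invariant_def FQSym_def by blast
      ultimately show "\<sigma> \<in> Z" using Z[of \<sigma>] d by blast
    qed
    fix y z assume "y \<in> Z" "z \<in> Z" "h y = h z"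
    then show "Poly_Mapping.lookup x y = Poly_Mapping.lookup x z"
      using gd_invariantD[OF x, of y "d y" z] Z[of y] Z[of z] by (auto simp: h_def)
  qed
  moreover have "(\<lambda>y. \<Sum>z | z \<in> Z \<and> h z = h y. Poly_Mapping.single z (1::'k)) ` Z
      \<subseteq> insert fq_one (R m ` A_words m)"
  proof clarify
    fix y assume y: "y \<in> Z"
      "(\<Sum>z | z \<in> Z \<and> h z = h y. Poly_Mapping.single z (1::'k)) \<notin> R m ` A_words m"
    have "{z \<in> Z. h z = h y} = {z. z \<in> m_perms m (d y) \<and> GD (d y) z = GD (d y) y}"
    proof (intro set_eqI)
      fix z
      have "z \<in> Z \<longleftrightarrow> z \<in> m_perms m (d y)" if "d z = d y"
        using Z[of z] Z[of y] y(1) that by auto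
      then show "z \<in> {z \<in> Z. h z = h y} \<longleftrightarrow> z \<in> {z. z \<in> m_perms m (d y) \<and> GD (d y) z = GD (d y) y}"
        using d[of z "d y"] by (auto simp: h_def)
    qed
    then have eq: "(\<Sum>z | z \<in> Z \<and> h z = h y. Poly_Mapping.single z (1::'k))
        = gd_sum m (d y) (GD (d y) y)"
      by (simp only: gd_sum_def F_def)
    \<comment> \<open>The sum is assumed not to be any \<open>R m w\<close>, so the case of positive
      degree is contradictory.\<close>
    show "(\<Sum>z | z \<in> Z \<and> h z = h y. Poly_Mapping.single z (1::'k)) = fq_one"
    proof (cases "d y")
      case 0
      then show ?thesis using eq by (simp add: gd_sum_0 GD_def)
    next
      case (Suc n)
      then have "(\<Sum>z | z \<in> Z \<and> h z = h y. Poly_Mapping.single z (1::'k)) = R m (GD (d y) y)"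
        unfolding eq R_gd_sum by (simp add: length_GD[OF m_pos])
      moreover have "GD (d y) y \<in> A_words m"
        using GD_in_A_words[OF m_pos] y(1) Z[of y] by blast
      ultimately show ?thesis using y(2) by blast
    qed
  qed
  ultimately show ?thesis
    using fvs.span_mono by blast
qed

text \<open>The invariants form a subalgebra containing every \<open>R m w\<close>. Conversely, each
  subalgebra containing these is a subspace that also contains the unit, hence contains the span of
  both, which is all the invariants.\<close>

lemma NCSF_eq: "(NCSF m :: 'k::field fq set) = gd_invariant m"
proof
  show "(NCSF m :: 'k fq set) \<subseteq> gd_invariant m"
    unfolding NCSF_def
    by (rule hull_minimal) (use R_in_gd_invariant subalgebra_gd_invariant in auto)
  have "gd_invariant m \<subseteq> A" if A: "subalgebra m A" "R m ` A_words m \<subseteq> A" for A :: "'k fq set"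
  proof -
    have "fvs.span (insert fq_one (R m ` A_words m)) \<subseteq> A"
      by (rule fvs.span_minimal) (use A in \<open>auto simp: subalgebra_def\<close>)
    then show ?thesis using gd_invariant_span by blast
  qed
  then show "(gd_invariant m :: 'k fq set) \<subseteq> NCSF m"
    unfolding NCSF_def hull_def by blast
qed

lemma R_product:
  fixes w w' :: "nat list"
  assumes "w \<in> A_words m" "w' \<in> A_words m"
  shows "fq_mult m (R m w) (R m w' :: 'k::field fq) = (\<Sum>k\<in>{0..m}. R m (w @ [k] @ w'))"
proof (rule FQSym_eqI)
  have R: "R m v \<in> FQSym m" for v
    using R_in_gd_invariant[of v] by (auto dest: gd_invariant_FQSym)
  show "fq_mult m (R m w) (R m w' :: 'k fq) \<in> FQSym m"
    by (intro fq_mult_in_FQSym[OF m_pos] R)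
  show "(\<Sum>k\<in>{0..m}. R m (w @ [k] @ w') :: 'k fq) \<in> FQSym m"
    by (intro fvs.subspace_sum subspace_FQSym R)
  fix n \<gamma> assume \<gamma>: "\<gamma> \<in> m_perms m n"
  let ?l = "length w + 1" and ?l' = "length w' + 1"
  let ?P = "n = ?l + ?l' \<and> (\<exists>k\<in>{0..m}. GD n \<gamma> = w @ [k] @ w')"
  have deg: "\<gamma> \<in> m_perms m n' \<longleftrightarrow> n' = n" for n'
    using \<gamma> m_perms_unique[OF m_pos \<gamma>, of n'] by auto
  have lo: "lo p \<gamma> \<in> m_perms m n' \<longleftrightarrow> n' = p" if "p \<le> n" for p n'
    using lo_in_m_perms[OF \<gamma> that] m_perms_unique[OF m_pos, of "lo p \<gamma>" n' p] by auto
  have hi: "hi p \<gamma> \<in> m_perms m n' \<longleftrightarrow> n' = n - p" if "p \<le> n" for p n'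
    using hi_in_m_perms[OF m_pos \<gamma> that] m_perms_unique[OF m_pos, of "hi p \<gamma>" n' "n - p"] by auto
  \<comment> \<open>Since \<open>lo p \<gamma>\<close> has degree p, only p = length w + 1 gives a
    nonzero term.\<close>
  have "Poly_Mapping.lookup (fq_mult m (R m w) (R m w' :: 'k fq)) \<gamma>
      = (\<Sum>p\<le>n. if p = ?l then (if n = ?l + ?l' \<and> GD p (lo p \<gamma>) = w \<and> GD (n - p) (hi p \<gamma>) = w'
          then 1 else 0) else 0)"
    unfolding lookup_fq_mult[OF m_pos R R \<gamma>]
    by (rule sum.cong) (auto simp: R_gd_sum lookup_gd_sum lo hi)
  also have "\<dots> = (if n = ?l + ?l' \<and> take (length w) (GD n \<gamma>) = w \<and> drop (length w + 1) (GD n \<gamma>) = w'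
      then 1 else 0)"
    using GD_lo[OF m_pos \<gamma>, of ?l] GD_hi[OF m_pos \<gamma>, of ?l] by (auto simp del: One_nat_def)
  \<comment> \<open>The entry skipped between the prefix and the suffix becomes k; it is a letter of
    A_m because every letter of \<gamma> occurs m times.\<close>
  also have "(n = ?l + ?l' \<and> take (length w) (GD n \<gamma>) = w \<and> drop (length w + 1) (GD n \<gamma>) = w') \<longleftrightarrow> ?P"
  proof (cases "n = ?l + ?l'")
    case True
    have "length (GD n \<gamma>) = length w + length w' + 1"
      using True by (simp add: length_GD[OF m_pos])
    note * = words_eq_split_iff[OF this]
    have "GD n \<gamma> ! length w \<in> {0..m}"
      using GD_in_A_words[OF m_pos \<gamma>] True by (auto simp: length_GD[OF m_pos] lists_eq_set subset_iff)
    moreover have "k = GD n \<gamma> ! length w" if "GD n \<gamma> = w @ [k] @ w'" for k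
      using that by simp
    ultimately show ?thesis using True * by metis
  qed simp
  \<comment> \<open>The letter k is determined by \<gamma>, so at most one summand is
    nonzero.\<close>
  also have "(if ?P then 1 else 0 :: 'k)
      = (\<Sum>k\<in>{0..m}. if n = ?l + ?l' \<and> GD n \<gamma> = w @ [k] @ w' then 1 else 0)"
  proof (cases ?P)
    case True
    then obtain k where k: "k \<in> {0..m}" "n = ?l + ?l'" "GD n \<gamma> = w @ [k] @ w'" by blast
    have "(\<Sum>k\<in>{0..m}. if n = ?l + ?l' \<and> GD n \<gamma> = w @ [k] @ w' then 1 else 0 :: 'k)
        = (\<Sum>j\<in>{0..m}. if j = k then 1 else 0)"
      by (rule sum.cong) (use k in auto)
    also have "\<dots> = 1" using k(1) by simp
    finally show ?thesis unfolding if_P[OF True] by (rule sym)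
  next
    case False
    then show ?thesis by (subst sum.neutral) auto
  qed
  also have "\<dots> = Poly_Mapping.lookup (\<Sum>k\<in>{0..m}. R m (w @ [k] @ w')) \<gamma>"
    unfolding lookup_sum by (rule sum.cong) (auto simp: R_gd_sum lookup_gd_sum deg)
  finally show "Poly_Mapping.lookup (fq_mult m (R m w) (R m w' :: 'k fq)) \<gamma>
    = Poly_Mapping.lookup (\<Sum>k\<in>{0..m}. R m (w @ [k] @ w')) \<gamma>" .
qed

text \<open>The degrees of the tensor factors are recorded because the induction for the antipode
  needs left factors of smaller degree.\<close>

lemma fq_comult_gd_homog:
  fixes x :: "'k::field fq"
  assumes x: "x \<in> gd_homog m n"
  shows "fq_comult m x
    \<in> fvs.span {tens y z | y z p q. p + q = n \<and> y \<in> gd_homog m p \<and> z \<in> gd_homog m q}"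
    (is "_ \<in> fvs.span ?T")
proof -
  have inv: "x \<in> gd_invariant m" and keys: "Poly_Mapping.keys x \<subseteq> m_perms m n"
    using x by (auto simp: gd_homog_def)
  define d where "d = (\<lambda>\<sigma> :: nat list. length \<sigma> div m)"
  \<comment> \<open>On \<open>Z\<close> the degree of b is n minus the degree of a, so the label
    needs only one of them.\<close>
  define h where "h = (\<lambda>(a, b). (d a, GD (d a) a, GD (d b) b))"
  define Z where "Z = (\<Union>p\<in>{..n}. m_perms m p \<times> m_perms m (n - p))"
  have d: "d \<sigma> = n" if "\<sigma> \<in> m_perms m n" for \<sigma> n
    using m_perms_degree[OF m_pos that] by (simp add: d_def)
  have Z: "(a, b) \<in> Z \<longleftrightarrow> d a \<le> n \<and> a \<in> m_perms m (d a) \<and> b \<in> m_perms m (n - d a)" for a b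
  proof
    assume "(a, b) \<in> Z"
    then obtain p where "p \<le> n" "a \<in> m_perms m p" "b \<in> m_perms m (n - p)"
      by (auto simp: Z_def)
    then show "d a \<le> n \<and> a \<in> m_perms m (d a) \<and> b \<in> m_perms m (n - d a)"
      using d[of a p] by simp
  qed (auto simp: Z_def)
  have "fq_comult m x
      \<in> fvs.span ((\<lambda>y. \<Sum>z | z \<in> Z \<and> h z = h y. Poly_Mapping.single z (1::'k)) ` Z)"
  proof (rule fibre_const_in_span)
    show "finite Z" by (auto simp: Z_def)
    show "Poly_Mapping.keys (fq_comult m x) \<subseteq> Z"
    proof clarify
      fix a b assume "(a, b) \<in> Poly_Mapping.keys (fq_comult m x)"
      then have "splittings m n a b \<noteq> {}"
        by (auto simp: in_keys_iff lookup_fq_comult_splittings[OF m_pos keys])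
      then obtain u v where "(u, v) \<in> splittings m n a b" by auto
      then obtain p q where "p + q = n" "a \<in> m_perms m p" "b \<in> m_perms m q"
        by (rule splittings_degrees[OF m_pos])
      then show "(a, b) \<in> Z" using d[of a p] by (auto simp: Z)
    qed
    fix y z assume yz: "y \<in> Z" "z \<in> Z" "h y = h z"
    obtain a b a' b' where [simp]: "y = (a, b)" "z = (a', b')" by fastforce
    define p where "p = d a"
    define q where "q = n - p"
    from yz have *: "p + q = n" "a \<in> m_perms m p" "a' \<in> m_perms m p" "b \<in> m_perms m q"
      "b' \<in> m_perms m q" "GD p a = GD p a'" "GD q b = GD q b'"
      using d[of b q] d[of b' q] by (auto simp: Z h_def p_def q_def)
    \<comment> \<open>The range of I depends only on n and p, so the two coefficients can be
      compared summand by summand.\<close>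
    show "Poly_Mapping.lookup (fq_comult m x) y = Poly_Mapping.lookup (fq_comult m x) z"
      unfolding \<open>y = (a, b)\<close> \<open>z = (a', b')\<close>
        lookup_fq_comult[OF m_pos keys *(2,4,1)] lookup_fq_comult[OF m_pos keys *(3,5,1)]
    proof (rule sum.cong[OF refl])
      fix I assume "I \<in> {I. I \<subseteq> {1..n} \<and> card I = p}"
      then have I: "I \<subseteq> {1..n}" "finite I" "card I = p" by (auto intro: finite_subset)
      have J: "finite ({1..n} - I)" "card ({1..n} - I) = q"
          "I \<inter> ({1..n} - I) = {}" "I \<union> ({1..n} - I) = {1..n}"
        using I *(1) by (auto simp: card_Diff_subset)
      show "Poly_Mapping.lookup x (map (enum_of I) a @ map (enum_of ({1..n} - I)) b)
          = Poly_Mapping.lookup x (map (enum_of I) a' @ map (enum_of ({1..n} - I)) b')"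
        by (rule gd_invariantD[OF inv, where n = n])
          (intro merge_in_m_perms[OF m_pos *(2) I(2,3) *(4) J]
            merge_in_m_perms[OF m_pos *(3) I(2,3) *(5) J]
            GD_merge_cong[OF m_pos *(2,3,6) I(2,3) *(4,5,7) J])+
    qed
  qed
  moreover have "(\<lambda>y. \<Sum>z | z \<in> Z \<and> h z = h y. Poly_Mapping.single z (1::'k)) ` Z \<subseteq> ?T"
  proof clarify
    fix a b assume ab: "(a, b) \<in> Z"
    define p where "p = d a"
    define q where "q = n - p"
    have pq: "p + q = n" "d b = q" using ab d[of b q] by (auto simp: Z p_def q_def)
    \<comment> \<open>A fibre of \<open>h\<close> is a product of two descent classes, so its sum is
      a pure tensor of class sums.\<close>
    have "{z \<in> Z. h z = h (a, b)} = {a'. a' \<in> m_perms m p \<and> GD p a' = GD p a}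
        \<times> {b'. b' \<in> m_perms m q \<and> GD q b' = GD q b}" (is "?L = ?R")
    proof (intro set_eqI)
      fix z show "z \<in> ?L \<longleftrightarrow> z \<in> ?R"
      proof (cases z)
        case (Pair a' b')
        show ?thesis
          using pq d[of a' p] d[of b' q] d[of b' "n - d a'"] unfolding Pair
          by (auto simp: h_def Z p_def[symmetric])
      qed
    qed
    then have "(\<Sum>z | z \<in> Z \<and> h z = h (a, b). Poly_Mapping.single z (1::'k))
        = tens (gd_sum m p (GD p a)) (gd_sum m q (GD q b))"
      unfolding gd_sum_def by (subst tens_sum_F) auto
    then show "\<exists>y z p q. (\<Sum>z | z \<in> Z \<and> h z = h (a, b). Poly_Mapping.single z (1::'k)) = tens y z \<and>
        p + q = n \<and> y \<in> gd_homog m p \<and> z \<in> gd_homog m q"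
      using pq gd_sum_in_gd_homog by blast
  qed
  ultimately show ?thesis
    using fvs.span_mono by blast
qed

end

section \<open>The antipode\<close>

text \<open>Convolution with respect to deconcatenation at every position. It computes
  \<open>fq_conv\<close> at an m-permutation once the cuts that the coproduct omits contribute zero
  and standardizing a block word changes nothing; \<open>sum_m_perm_splits\<close> makes this
  precise.\<close>

definition word_conv ::
    "nat \<Rightarrow> (nat list \<Rightarrow> 'k::field fq) \<Rightarrow> (nat list \<Rightarrow> 'k fq) \<Rightarrow> nat list \<Rightarrow> 'k fq" where
  "word_conv m f g \<alpha> = (\<Sum>k\<le>length \<alpha>. fq_mult m (f (take k \<alpha>)) (g (drop k \<alpha>)))"

definition word_unit :: "nat list \<Rightarrow> 'k::field fq" where
  "word_unit \<alpha> = (if \<alpha> = [] then fq_one else 0)"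

text \<open>The identity map in terms of words: it is \<open>F\<close> on m-permutations, and the
  value 0 off the block words removes the cuts that the coproduct does not have.\<close>

definition std_F :: "nat \<Rightarrow> nat list \<Rightarrow> 'k::field fq" where
  "std_F m v = (if block_word m v then F (std m v) else 0)"

text \<open>Obtained by solving \<open>word_conv m (word_inv m) (std_F m) \<alpha> = 0\<close> for
  the summand with the full prefix, whose right factor is the unit.\<close>

function word_inv :: "nat \<Rightarrow> nat list \<Rightarrow> 'k::field fq" where
  "word_inv m \<alpha> = (if \<alpha> = [] then fq_one
     else - (\<Sum>k<length \<alpha>. fq_mult m (word_inv m (take k \<alpha>)) (std_F m (drop k \<alpha>))))"
  by auto
termination by (relation "measure (length \<circ> snd)") auto

declare word_inv.simps [simp del]

text \<open>
  \<open>word_inv\<close> is a left inverse of \<open>std_F\<close> by construction; it is a right inverse because it coincides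
  with the right inverse \<open>word_rinv\<close>.
\<close>

function word_rinv :: "nat \<Rightarrow> nat list \<Rightarrow> 'k::field fq" where
  "word_rinv m \<alpha> = (if \<alpha> = [] then fq_one
     else - (\<Sum>k\<in>{1..length \<alpha>}. fq_mult m (std_F m (take k \<alpha>)) (word_rinv m (drop k \<alpha>))))"
  by auto
termination by (relation "measure (length \<circ> snd)") auto

declare word_rinv.simps [simp del]

lemma word_inv_Nil [simp]: "word_inv m [] = fq_one"
  by (simp add: word_inv.simps)

lemma std_F_Nil [simp]: "std_F m [] = fq_one"
  by (simp add: std_F_def block_word_def fq_one_def)

lemma word_conv_unit_right: "word_conv m f word_unit \<alpha> = f \<alpha>"
proof -
  have "word_conv m f word_unit \<alpha> = (\<Sum>k\<le>length \<alpha>. if k = length \<alpha> then f \<alpha> else 0)"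
    unfolding word_conv_def by (rule sum.cong) (auto simp: word_unit_def)
  then show ?thesis by simp
qed

lemma word_conv_unit_left: "word_conv m word_unit f \<alpha> = f \<alpha>"
proof -
  have "word_conv m word_unit f \<alpha> = (\<Sum>k\<le>length \<alpha>. if k = 0 then f \<alpha> else 0)"
    unfolding word_conv_def by (rule sum.cong) (auto simp: word_unit_def)
  then show ?thesis by simp
qed

lemma word_inv_conv_std_F: "word_conv m (word_inv m) (std_F m) = word_unit"
proof
  fix \<alpha> :: "nat list"
  have "word_conv m (word_inv m) (std_F m) \<alpha>
      = (\<Sum>k<length \<alpha>. fq_mult m (word_inv m (take k \<alpha>)) (std_F m (drop k \<alpha>)))
        + word_inv m \<alpha>"
    by (simp add: word_conv_def flip: lessThan_Suc_atMost)
  then show "word_conv m (word_inv m) (std_F m) \<alpha> = word_unit \<alpha>"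
    by (cases "\<alpha> = []") (simp_all add: word_unit_def word_inv.simps[of m \<alpha>])
qed

lemma std_F_conv_word_rinv: "word_conv m (std_F m) (word_rinv m) = word_unit"
proof
  fix \<alpha> :: "nat list"
  have "{..length \<alpha>} = insert 0 {1..length \<alpha>}" by auto
  then have "word_conv m (std_F m) (word_rinv m) \<alpha>
      = word_rinv m \<alpha>
        + (\<Sum>k\<in>{1..length \<alpha>}. fq_mult m (std_F m (take k \<alpha>)) (word_rinv m (drop k \<alpha>)))"
    by (simp add: word_conv_def)
  then show "word_conv m (std_F m) (word_rinv m) \<alpha> = word_unit \<alpha>"
    by (cases "\<alpha> = []")
      (simp_all add: word_unit_def word_rinv.simps[of m \<alpha>] word_rinv.simps[of m "[]"])
qed

lemma m_word_append: "m_word m u \<Longrightarrow> m_word m v \<Longrightarrow> m_word m (u @ v)"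
  by (simp add: m_word_def)

lemma m_word_block_word: "block_word m u \<Longrightarrow> m_word m u"
  unfolding block_word_def m_word_def by (metis count_notin dvd_0_right dvd_refl)

lemma std_F_eq_0: "\<not> m_word m v \<Longrightarrow> std_F m v = 0"
  by (auto simp: std_F_def m_word_block_word)

text \<open>A concatenation of m-words is an m-word, so at every cut of \<alpha> one of the two
  factors fails to be one and the summand vanishes.\<close>

lemma word_inv_eq_0: "\<not> m_word m \<alpha> \<Longrightarrow> word_inv m \<alpha> = (0 :: 'k::field fq)"
proof (induction \<alpha> rule: length_induct)
  case (1 \<alpha>)
  have "fq_mult m (word_inv m (take k \<alpha>)) (std_F m (drop k \<alpha>)) = (0 :: 'k fq)" if "k < length \<alpha>" for k
  proof (cases "m_word m (take k \<alpha>)")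
    case True
    then have "\<not> m_word m (drop k \<alpha>)"
      using 1(2) m_word_append[of m "take k \<alpha>" "drop k \<alpha>"] by auto
    then show ?thesis by (simp add: std_F_eq_0)
  next
    case False
    then have "word_inv m (take k \<alpha>) = (0 :: 'k fq)" using 1(1) that by simp
    then show ?thesis by simp
  qed
  moreover have "\<alpha> \<noteq> []" using 1(2) by (auto simp: m_word_def)
  ultimately show ?case by (simp add: word_inv.simps[of m \<alpha>])
qed

lemma std_F_map:
  assumes "strict_mono_on (set w) f" shows "std_F m (map f w) = std_F m w"
proof -
  have "count_list (map f w) (f a) = count_list w a" if "a \<in> set w" for a
    by (rule count_list_map_inj_on)
      (use strict_mono_on_imp_inj_on[OF assms] that in \<open>simp add: insert_absorb\<close>)
  then have "block_word m (map f w) \<longleftrightarrow> block_word m w"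
    by (simp add: block_word_def)
  then show ?thesis using assms by (simp add: std_F_def std_map)
qed

text \<open>The recursion sees the letters only through \<open>std_F\<close>, which depends on their
  relative order alone.\<close>

lemma word_inv_map: "strict_mono_on (set w) f \<Longrightarrow> word_inv m (map f w) = (word_inv m w :: 'k::field fq)"
proof (induction w rule: length_induct)
  case (1 w)
  have "strict_mono_on (set (take k w)) f" "strict_mono_on (set (drop k w)) f" for k
    by (rule monotone_on_subset[OF 1(2) set_take_subset],
        rule monotone_on_subset[OF 1(2) set_drop_subset])
  then have "(\<Sum>k<length w. fq_mult m (word_inv m (map f (take k w))) (std_F m (map f (drop k w))) :: 'k fq)
      = (\<Sum>k<length w. fq_mult m (word_inv m (take k w)) (std_F m (drop k w)))"
    using 1(1) by (intro sum.cong refl) (simp add: std_F_map)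
  then show ?case
    by (simp add: word_inv.simps[of m w] word_inv.simps[of m "map f w"] take_map drop_map)
qed

lemma fq_mult_lin_ext_left:
  "fq_mult m (lin_ext fscale f x) z = lin_ext fscale (\<lambda>a. fq_mult m (f a) z) x"
  by (simp add: lin_ext_def fq_mult_sum_left fq_mult_scale_left)

lemma fq_mult_lin_ext_right:
  "fq_mult m z (lin_ext fscale f x) = lin_ext fscale (\<lambda>a. fq_mult m z (f a)) x"
  by (simp add: lin_ext_def fq_mult_sum_right fq_mult_scale_right)

lemma lin_ext_fq_comult:
  "lin_ext fscale (\<lambda>(a, b). h a b) (fq_comult m x) = lin_ext fscale
     (\<lambda>\<alpha>. \<Sum>(u, v) | u @ v = \<alpha> \<and> m_word m u \<and> m_word m v. h (std m u) (std m v)) x"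
  unfolding fq_comult_lin_ext fvs.lin_ext_lin_ext
  by (simp add: fvs.lin_ext_sum tens_F case_prod_unfold)

lemma sum_m_word_splits:
  assumes "\<And>u v. \<not> (m_word m u \<and> m_word m v) \<Longrightarrow> h u v = (0 :: 'a::comm_monoid_add)"
  shows "(\<Sum>(u, v) | u @ v = \<alpha> \<and> m_word m u \<and> m_word m v. h u v)
    = (\<Sum>k\<le>length \<alpha>. h (take k \<alpha>) (drop k \<alpha>))"
proof -
  have "(\<Sum>(u, v) | u @ v = \<alpha> \<and> m_word m u \<and> m_word m v. h u v)
      = (\<Sum>(u, v)\<in>{(u, v). u @ v = \<alpha>}. h u v)"
  proof (rule sum.mono_neutral_left)
    show "finite {(u, v). u @ v = \<alpha>}" by (simp add: append_eq_image)
  qed (use assms in auto)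
  also have "\<dots> = (\<Sum>k\<le>length \<alpha>. h (take k \<alpha>) (drop k \<alpha>))"
  proof -
    have "inj_on (\<lambda>k. (take k \<alpha>, drop k \<alpha>)) {..length \<alpha>}"
      by (rule inj_on_inverseI[where g = "\<lambda>(u, v). length u"]) simp
    then show ?thesis by (simp add: append_eq_image sum.reindex)
  qed
  finally show ?thesis .
qed

definition antipode :: "nat \<Rightarrow> 'k::field fq \<Rightarrow> 'k fq" where
  "antipode m = lin_ext fscale (word_inv m)"

lemma antipode_F [simp]: "antipode m (F \<alpha>) = word_inv m \<alpha>"
  by (simp add: antipode_def F_def)

lemma lin_ext_word_unit: "lin_ext fscale word_unit x = fscale (fq_counit x) fq_one"
proof -
  have "lin_ext fscale word_unit x
      = (\<Sum>a\<in>Poly_Mapping.keys x. if a = [] then fscale (Poly_Mapping.lookup x []) fq_one else 0)"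
    unfolding lin_ext_def by (rule sum.cong) (auto simp: word_unit_def)
  also have "\<dots> = fscale (fq_counit x) fq_one"
    by (auto simp: fq_counit_def in_keys_iff intro!: poly_mapping_eqI)
  finally show ?thesis .
qed

context
  fixes m :: nat
  assumes m_pos: "m \<ge> 1"
begin

lemma std_F_in_FQSym: "std_F m w \<in> (FQSym m :: 'k::field fq set)"
  using F_in_FQSym[OF std_in_m_perms[OF m_pos]] fvs.subspace_0[OF subspace_FQSym]
  by (auto simp: std_F_def)

lemma word_inv_in_FQSym: "word_inv m w \<in> (FQSym m :: 'k::field fq set)"
proof (induction w rule: length_induct)
  case (1 w)
  then show ?case
    unfolding word_inv.simps[of m w]
    by (auto intro!: fq_one_in_FQSym fvs.subspace_neg subspace_FQSym fvs.subspace_sum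
        fq_mult_in_FQSym[OF m_pos] std_F_in_FQSym)
qed

lemma word_rinv_in_FQSym: "word_rinv m w \<in> (FQSym m :: 'k::field fq set)"
proof (induction w rule: length_induct)
  case (1 w)
  then show ?case
    unfolding word_rinv.simps[of m w]
    by (auto intro!: fq_one_in_FQSym fvs.subspace_neg subspace_FQSym fvs.subspace_sum
        fq_mult_in_FQSym[OF m_pos] std_F_in_FQSym)
qed

text \<open>Both sides run over the cuts of \<alpha> into three factors, with the product
  reassociated.\<close>

lemma word_conv_assoc:
  fixes f g h :: "nat list \<Rightarrow> 'k::field fq"
  assumes "\<And>w. f w \<in> FQSym m" "\<And>w. g w \<in> FQSym m" "\<And>w. h w \<in> FQSym m"
  shows "word_conv m (word_conv m f g) h \<alpha> = word_conv m f (word_conv m g h) \<alpha>"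
proof -
  let ?A = "\<lambda>p q. fq_mult m (f (take p \<alpha>))
    (fq_mult m (g (take q (drop p \<alpha>))) (h (drop q (drop p \<alpha>))))"
  have "word_conv m (word_conv m f g) h \<alpha> = (\<Sum>r\<le>length \<alpha>. \<Sum>p\<le>r. ?A p (r - p))"
    unfolding word_conv_def fq_mult_sum_left
    by (intro sum.cong) (auto simp: min_def drop_take fq_mult_assoc[OF m_pos] assms)
  also have "\<dots> = (\<Sum>p\<le>length \<alpha>. \<Sum>q\<le>length \<alpha> - p. ?A p q)"
    by (rule sum_triangle)
  also have "\<dots> = word_conv m f (word_conv m g h) \<alpha>"
    by (simp add: word_conv_def fq_mult_sum_right)
  finally show ?thesis .
qed

text \<open>The monoid argument: for an associative operation, a left and a right inverse of the
  same element coincide.\<close>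

lemma word_rinv_eq_word_inv: "word_rinv m = (word_inv m :: nat list \<Rightarrow> 'k::field fq)"
proof
  fix \<alpha>
  have "word_inv m \<alpha> = (word_conv m (word_inv m) (word_conv m (std_F m) (word_rinv m)) \<alpha> :: 'k fq)"
    by (simp add: std_F_conv_word_rinv word_conv_unit_right)
  also have "\<dots> = word_conv m (word_conv m (word_inv m) (std_F m)) (word_rinv m) \<alpha>"
    by (rule word_conv_assoc[symmetric])
      (rule word_inv_in_FQSym std_F_in_FQSym word_rinv_in_FQSym)+
  also have "\<dots> = word_rinv m \<alpha>"
    by (simp add: word_inv_conv_std_F word_conv_unit_left)
  finally show "word_rinv m \<alpha> = (word_inv m \<alpha> :: 'k fq)" by (rule sym)
qed

lemma word_inv_std: "block_word m u \<Longrightarrow> word_inv m (std m u) = word_inv m u"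
  by (simp add: std_block_word word_inv_map strict_mono_on_rank_in)

text \<open>Factors of an m-permutation that are m-words are block words, where \<open>h\<close>
  after standardization agrees with h'; at all other cuts h' is zero.\<close>

lemma sum_m_perm_splits:
  assumes \<alpha>: "\<alpha> \<in> m_perms m n"
    and h: "\<And>u v. block_word m u \<Longrightarrow> block_word m v \<Longrightarrow> h (std m u) (std m v) = h' u v"
    and h': "\<And>u v. \<not> (m_word m u \<and> m_word m v) \<Longrightarrow> h' u v = (0 :: 'a::comm_monoid_add)"
  shows "(\<Sum>(u, v) | u @ v = \<alpha> \<and> m_word m u \<and> m_word m v. h (std m u) (std m v))
    = (\<Sum>k\<le>length \<alpha>. h' (take k \<alpha>) (drop k \<alpha>))"
proof -
  have "(\<Sum>(u, v) | u @ v = \<alpha> \<and> m_word m u \<and> m_word m v. h (std m u) (std m v))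
      = (\<Sum>(u, v) | u @ v = \<alpha> \<and> m_word m u \<and> m_word m v. h' u v)"
    by (rule sum.cong) (use \<alpha> split_m_perm[OF m_pos] in \<open>auto intro!: h\<close>)
  then show ?thesis using sum_m_word_splits[of m h', OF h'] by simp
qed

lemma antipode_in_FQSym: "x \<in> FQSym m \<Longrightarrow> antipode m x \<in> (FQSym m :: 'k::field fq set)"
  unfolding antipode_def by (intro fvs.lin_ext_in_subspace subspace_FQSym word_inv_in_FQSym)

lemma fq_antipode_antipode: "fq_antipode m (antipode m :: 'k::field fq \<Rightarrow> 'k fq)"
  unfolding fq_antipode_def linear_map_on_def
proof (intro conjI ballI allI)
  show "antipode m \<in> FQSym m \<rightarrow> (FQSym m :: 'k fq set)"
    using antipode_in_FQSym by auto
  show "antipode m (x + y) = antipode m x + (antipode m y :: 'k fq)" for x y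
    by (simp add: antipode_def fvs.lin_ext_add)
  show "antipode m (fscale c x) = (fscale c (antipode m x) :: 'k fq)" for c x
    by (simp add: antipode_def fvs.lin_ext_scale)
next
  fix x :: "'k fq" assume x: "x \<in> FQSym m"
  have "fq_conv m (antipode m) (\<lambda>y. y) x = lin_ext fscale word_unit x"
    unfolding fq_conv_lin_ext lin_ext_fq_comult
  proof (rule fvs.lin_ext_cong)
    fix \<alpha> assume "\<alpha> \<in> Poly_Mapping.keys x"
    then obtain n where \<alpha>: "\<alpha> \<in> m_perms m n" using x unfolding FQSym_def by blast
    have "(\<Sum>(u, v) | u @ v = \<alpha> \<and> m_word m u \<and> m_word m v.
        fq_mult m (antipode m (F (std m u))) (F (std m v)))
      = (\<Sum>k\<le>length \<alpha>. fq_mult m (word_inv m (take k \<alpha>)) (std_F m (drop k \<alpha>) :: 'k fq))"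
      by (rule sum_m_perm_splits[OF \<alpha>, where h = "\<lambda>a b. fq_mult m (antipode m (F a)) (F b)"])
        (auto simp: word_inv_std std_F_def word_inv_eq_0 m_word_block_word)
    then show "(\<Sum>(u, v) | u @ v = \<alpha> \<and> m_word m u \<and> m_word m v.
        fq_mult m (antipode m (F (std m u))) (F (std m v))) = (word_unit \<alpha> :: 'k fq)"
      by (simp only: word_conv_def[symmetric] word_inv_conv_std_F)
  qed
  then show "fq_conv m (antipode m) (\<lambda>y. y) x = fscale (fq_counit x) fq_one"
    by (simp only: lin_ext_word_unit)
  have "fq_conv m (\<lambda>y. y) (antipode m) x = lin_ext fscale word_unit x"
    unfolding fq_conv_lin_ext lin_ext_fq_comult
  proof (rule fvs.lin_ext_cong)
    fix \<alpha> assume "\<alpha> \<in> Poly_Mapping.keys x"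
    then obtain n where \<alpha>: "\<alpha> \<in> m_perms m n" using x unfolding FQSym_def by blast
    have "(\<Sum>(u, v) | u @ v = \<alpha> \<and> m_word m u \<and> m_word m v.
        fq_mult m (F (std m u)) (antipode m (F (std m v))))
      = (\<Sum>k\<le>length \<alpha>. fq_mult m (std_F m (take k \<alpha>)) (word_inv m (drop k \<alpha>) :: 'k fq))"
      by (rule sum_m_perm_splits[OF \<alpha>, where h = "\<lambda>a b. fq_mult m (F a) (antipode m (F b))"])
        (auto simp: word_inv_std std_F_def word_inv_eq_0 m_word_block_word)
    then show "(\<Sum>(u, v) | u @ v = \<alpha> \<and> m_word m u \<and> m_word m v.
        fq_mult m (F (std m u)) (antipode m (F (std m v)))) = (word_unit \<alpha> :: 'k fq)"
      by (simp only: word_conv_def[symmetric] std_F_conv_word_rinv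
          word_rinv_eq_word_inv[symmetric])
  qed
  then show "fq_conv m (\<lambda>y. y) (antipode m) x = fscale (fq_counit x) fq_one"
    by (simp only: lin_ext_word_unit)
qed

text \<open>
  The left tensor factors that contribute here have degree less than n, which allows an induction
  on the degree.
\<close>

lemma antipode_recursion:
  fixes x :: "'k::field fq"
  assumes "Poly_Mapping.keys x \<subseteq> m_perms m n" "n \<noteq> 0"
  shows "antipode m x = - lin_ext fscale
    (\<lambda>(a, b). if b = [] then 0 else fq_mult m (word_inv m a) (F b)) (fq_comult m x)"
proof -
  have "lin_ext fscale (\<lambda>(a, b). if b = [] then 0 else fq_mult m (word_inv m a) (F b)) (fq_comult m x)
      = lin_ext fscale (\<lambda>\<alpha>. fscale (- 1) (word_inv m \<alpha>)) x"
    unfolding lin_ext_fq_comult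
  proof (rule fvs.lin_ext_cong)
    fix \<alpha> assume "\<alpha> \<in> Poly_Mapping.keys x"
    then have \<alpha>: "\<alpha> \<in> m_perms m n" "\<alpha> \<noteq> []"
      using assms Nil_in_m_perms[OF m_pos, of n] by auto
    have "(\<Sum>(u, v) | u @ v = \<alpha> \<and> m_word m u \<and> m_word m v.
        if std m v = [] then 0 else fq_mult m (word_inv m (std m u)) (F (std m v)))
      = (\<Sum>k\<le>length \<alpha>. if drop k \<alpha> = [] then 0
          else fq_mult m (word_inv m (take k \<alpha>)) (std_F m (drop k \<alpha>) :: 'k fq))"
      by (rule sum_m_perm_splits[OF \<alpha>(1), where
            h = "\<lambda>a b. if b = [] then 0 else fq_mult m (word_inv m a) (F b)"])
        (auto simp: word_inv_std std_F_def word_inv_eq_0 m_word_block_word)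
    also have "\<dots> = (\<Sum>k<length \<alpha>. fq_mult m (word_inv m (take k \<alpha>)) (std_F m (drop k \<alpha>)))"
      by (rule sum.mono_neutral_cong_right) auto
    also have "\<dots> = fscale (- 1) (word_inv m \<alpha>)"
      using \<alpha>(2) by (simp add: word_inv.simps[of m \<alpha>])
    finally show "(\<Sum>(u, v) | u @ v = \<alpha> \<and> m_word m u \<and> m_word m v.
        if std m v = [] then 0 else fq_mult m (word_inv m (std m u)) (F (std m v)))
      = fscale (- 1) (word_inv m \<alpha> :: 'k fq)" .
  qed
  then show ?thesis
    by (simp only: fvs.lin_ext_fun_scale antipode_def) simp
qed

lemma antipode_gd_homog: "x \<in> gd_homog m n \<Longrightarrow> antipode m x \<in> (gd_invariant m :: 'k::field fq set)"
proof (induction n arbitrary: x rule: less_induct)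
  case (less n)
  have keys: "Poly_Mapping.keys x \<subseteq> m_perms m n" using less.prems by (simp add: gd_homog_def)
  show ?case
  proof (cases "n = 0")
    case True
    show ?thesis
      unfolding antipode_def
    proof (rule fvs.lin_ext_in_subspace[OF subspace_gd_invariant])
      fix a assume "a \<in> Poly_Mapping.keys x"
      then have "a = []" using keys True by (auto simp: m_perms_0)
      then show "word_inv m a \<in> (gd_invariant m :: 'k fq set)"
        by (simp add: fq_one_in_gd_invariant[OF m_pos])
    qed
  next
    case False
    let ?\<Psi> = "lin_ext fscale
      (\<lambda>(a, b). if b = [] then 0 else fq_mult m (word_inv m a) (F b) :: 'k fq)"
    have tens: "?\<Psi> (tens y z) \<in> gd_invariant m"
      if "p + q = n" "y \<in> gd_homog m p" "z \<in> gd_homog m q" for y z p q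
    proof (cases "q = 0")
      \<comment> \<open>Here z is a multiple of the unit, and the recursion leaves such tensors
        out.\<close>
      case True
      have "lin_ext fscale (\<lambda>b. if b = [] then 0 else fq_mult m (word_inv m a) (F b) :: 'k fq) z
          = 0" for a
        unfolding lin_ext_def
        by (rule sum.neutral) (use that True in \<open>auto simp: gd_homog_def m_perms_0\<close>)
      then have "?\<Psi> (tens y z) = 0"
        by (simp add: fvs.lin_ext_tens)
      then show ?thesis by (simp add: fvs.subspace_0 subspace_gd_invariant)
    next
      case False
      have "lin_ext fscale (\<lambda>b. if b = [] then 0 else fq_mult m (word_inv m a) (F b) :: 'k fq) z
          = lin_ext fscale (\<lambda>b. fq_mult m (word_inv m a) (F b)) z" for a
        by (rule fvs.lin_ext_cong)
          (use that False Nil_in_m_perms[OF m_pos, of q] in \<open>auto simp: gd_homog_def\<close>)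
      \<comment> \<open>Bilinearity collects the basis terms into the antipode of y times z; the
        induction hypothesis applies to y because q > 0.\<close>
      then have "?\<Psi> (tens y z) = fq_mult m (antipode m y) z"
        by (simp add: fvs.lin_ext_tens antipode_def fq_mult_lin_ext_left lin_ext_F
            flip: fq_mult_lin_ext_right)
      moreover have "antipode m y \<in> gd_invariant m"
        using less.IH[of p y] that False by simp
      moreover have "z \<in> gd_invariant m" using that by (simp add: gd_homog_def)
      ultimately show ?thesis using fq_mult_in_gd_invariant[OF m_pos] by simp
    qed
    have "fq_comult m x
      \<in> fvs.span {tens y z | y z p q. p + q = n \<and> y \<in> gd_homog m p \<and> z \<in> gd_homog m q}"
      by (rule fq_comult_gd_homog[OF m_pos less.prems])
    then have "?\<Psi> (fq_comult m x) \<in> gd_invariant m"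
    proof (induction rule: fvs.span_induct_alt)
      case base
      then show ?case by (simp add: fvs.subspace_0 subspace_gd_invariant)
    next
      case (step c D D')
      then have "?\<Psi> D \<in> gd_invariant m" using tens by blast
      then show ?case
        unfolding fvs.lin_ext_add fvs.lin_ext_scale
        using step(2) by (intro fvs.subspace_add fvs.subspace_scale subspace_gd_invariant)
    qed
    then show ?thesis
      unfolding antipode_recursion[OF keys False]
      by (intro fvs.subspace_neg subspace_gd_invariant)
  qed
qed

text \<open>The unit and the \<open>R m w\<close> span the invariants and are homogeneous, so a
  linear map may be tested on homogeneous invariants. This covers both the coproduct and the
  antipode.\<close>

lemma gd_invariant_linear_image:
  fixes f :: "'k::field fq \<Rightarrow> 'b::ab_group_add"
  assumes V: "vector_space s" "module.subspace s V"
    and add: "\<And>x y. f (x + y) = f x + f y" and scale: "\<And>c x. f (fscale c x) = s c (f x)"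
    and homog: "\<And>n x. x \<in> gd_homog m n \<Longrightarrow> f x \<in> V" and x: "x \<in> gd_invariant m"
  shows "f x \<in> V"
proof -
  interpret V: vector_space s by (rule V(1))
  have one: "f fq_one \<in> V"
    using homog[of "gd_sum m 0 []" 0] gd_sum_in_gd_homog[OF m_pos, of 0 "[]", where 'k = 'k]
      gd_sum_0[OF m_pos, where 'a = 'k] by simp
  have R: "f (R m w) \<in> V" for w
    unfolding R_gd_sum by (rule homog[OF gd_sum_in_gd_homog[OF m_pos]])
  have "f 0 = 0" using add[of 0 0] by simp
  with gd_invariant_span[OF m_pos x] show ?thesis
  proof (induction rule: fvs.span_induct_alt)
    case base
    then show ?case using V.subspace_0[OF V(2)] by simp
  next
    case (step c y z)
    then have "f y \<in> V" using one R by auto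
    then show ?case
      using step unfolding add scale by (intro V.subspace_add V.subspace_scale V(2)) auto
  qed
qed

lemma hopf_subalgebra_NCSF: "hopf_subalgebra m (NCSF m :: 'k::field fq set)"
  unfolding hopf_subalgebra_def NCSF_eq[OF m_pos]
proof (intro conjI ballI exI)
  let ?S = "{tens y z | y z. y \<in> gd_invariant m \<and> z \<in> (gd_invariant m :: 'k fq set)}"
  show "subalgebra m (gd_invariant m :: 'k fq set)"
    by (rule subalgebra_gd_invariant[OF m_pos])
  show "fq_comult m x \<in> fvs.span ?S" if x: "x \<in> gd_invariant m" for x :: "'k fq"
  proof (rule gd_invariant_linear_image[OF fvs.vector_space_axioms fvs.subspace_span _ _ _ x])
    fix n and y :: "'k fq" assume "y \<in> gd_homog m n"
    then have "fq_comult m y \<in>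
        fvs.span {tens y z | y z p q. p + q = n \<and> y \<in> gd_homog m p \<and> z \<in> gd_homog m q}"
      by (rule fq_comult_gd_homog[OF m_pos])
    moreover have "{tens y z | y z p q. p + q = n \<and> y \<in> gd_homog m p \<and> z \<in> gd_homog m q} \<subseteq> ?S"
      by (auto simp: gd_homog_def)
    ultimately show "fq_comult m y \<in> fvs.span ?S" using fvs.span_mono by blast
  qed (simp_all add: fq_comult_lin_ext fvs.lin_ext_add fvs.lin_ext_scale)
  show "fq_antipode m (antipode m :: 'k fq \<Rightarrow> 'k fq)"
    by (rule fq_antipode_antipode)
  show "antipode m ` gd_invariant m \<subseteq> (gd_invariant m :: 'k fq set)"
  proof clarify
    fix x :: "'k fq" assume x: "x \<in> gd_invariant m"
    show "antipode m x \<in> gd_invariant m"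
      by (rule gd_invariant_linear_image[OF fvs.vector_space_axioms subspace_gd_invariant _ _ _ x])
        (simp_all add: antipode_gd_homog, simp_all add: antipode_def fvs.lin_ext_add fvs.lin_ext_scale)
  qed
qed

end

section \<open>Freeness\<close>

lemma count_list_replicate: "count_list (replicate n x) y = (if x = y then n else 0)"
  by (induction n) auto

text \<open>An arbitrary representative of a descent class; \<open>ex_GD\<close> provides one for
  every word on A_m.\<close>

definition gd_witness :: "nat \<Rightarrow> nat list \<Rightarrow> nat list" where
  "gd_witness m w = (SOME \<sigma>. \<sigma> \<in> m_perms m (length w + 1) \<and> GD (length w + 1) \<sigma> = w)"

text \<open>
  The coordinate of x at \<open>R m w\<close> is the coefficient of any permutation with descent word w;
  \<open>R_ext\<close> reads it off at the witness.
\<close>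

definition R_ext ::
    "('k::field \<Rightarrow> 'v::ab_group_add \<Rightarrow> 'v) \<Rightarrow> nat \<Rightarrow> (nat list \<Rightarrow> 'v) \<Rightarrow> 'k fq \<Rightarrow> 'v" where
  "R_ext s m f = lin_ext s (\<lambda>\<sigma>. if \<sigma> = gd_witness m (GD (length \<sigma> div m) \<sigma>)
     then f (GD (length \<sigma> div m) \<sigma>) else 0)"

lemma (in vector_space) R_ext_add: "R_ext scale m f (x + y) = R_ext scale m f x + R_ext scale m f y"
  by (simp add: R_ext_def lin_ext_add)

lemma (in vector_space) R_ext_scale: "R_ext scale m f (fscale c x) = scale c (R_ext scale m f x)"
  by (simp add: R_ext_def lin_ext_scale)

lemma (in vector_space) R_ext_fun_add:
  "R_ext scale m (\<lambda>w. f w + g w) x = R_ext scale m f x + R_ext scale m g x"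
  by (simp add: R_ext_def if_distrib cong: if_cong flip: lin_ext_fun_add)

lemma (in vector_space) R_ext_fun_scale:
  "R_ext scale m (\<lambda>w. scale c (f w)) x = scale c (R_ext scale m f x)"
  by (simp add: R_ext_def flip: lin_ext_fun_scale) (rule lin_ext_cong, simp)

lemma linear_map_on_comp:
  "linear_map_on s V s' V' f \<Longrightarrow> linear_map_on s' V' s'' V'' g \<Longrightarrow>
    linear_map_on s V s'' V'' (\<lambda>x. g (f x))"
  unfolding linear_map_on_def Pi_iff by metis

lemma linear_map_on_span_eq:
  fixes B :: "'k::field fq set" and f g :: "'k fq \<Rightarrow> 'b::ab_group_add"
  assumes f: "linear_map_on fscale (fvs.span B) s' V' f"
    and g: "linear_map_on fscale (fvs.span B) s' V'' g"
    and eq: "\<And>b. b \<in> B \<Longrightarrow> f b = g b" and x: "x \<in> fvs.span B"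
  shows "f x = g x"
proof -
  have 0: "h 0 = 0" if "linear_map_on fscale (fvs.span B) s' W h" for W and h :: "'k fq \<Rightarrow> 'b"
  proof -
    have "h (0 + 0) = h 0 + h 0"
      using that fvs.span_zero unfolding linear_map_on_def by blast
    then show ?thesis by simp
  qed
  \<comment> \<open>Linearity is available only on the span, so membership has to be carried through
    the induction.\<close>
  from x have "x \<in> fvs.span B \<and> f x = g x"
  proof (induction rule: fvs.span_induct_alt)
    case base
    then show ?case by (simp add: 0[OF f] 0[OF g] fvs.span_zero)
  next
    case (step c y z)
    then have "fscale c y \<in> fvs.span B" "y \<in> fvs.span B" "z \<in> fvs.span B"
      by (auto intro: fvs.span_base fvs.span_scale)
    moreover from this have "h (fscale c y + z) = s' c (h y) + h z"
      if "linear_map_on fscale (fvs.span B) s' W h" for W and h :: "'k fq \<Rightarrow> 'b"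
      using that unfolding linear_map_on_def by metis
    ultimately show ?case
      using f g eq step by (metis fvs.span_add)
  qed
  then show ?thesis ..
qed

section \<open>Words evaluated in an As-algebra\<close>

lemma bilinear_op_onD:
  assumes "bilinear_op_on s V f"
  shows "x \<in> V \<Longrightarrow> linear_map_on s V s V (f x)" "y \<in> V \<Longrightarrow> linear_map_on s V s V (\<lambda>x. f x y)"
    "x \<in> V \<Longrightarrow> y \<in> V \<Longrightarrow> f x y \<in> V"
  using assms unfolding bilinear_op_on_def linear_map_on_def by blast+

text \<open>The value forced at \<open>R m w\<close> on a homomorphism that sends
  \<open>R m []\<close> to b: the left-bracketed product of copies of b, joined by the operations
  named in w.\<close>

definition word_val :: "(nat \<Rightarrow> 'w \<Rightarrow> 'w \<Rightarrow> 'w) \<Rightarrow> 'w \<Rightarrow> nat list \<Rightarrow> 'w" where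
  "word_val op b w = foldl (\<lambda>x k. op k x b) b w"

lemma word_val_simps [simp]:
  "word_val op b [] = b" "word_val op b (w @ [k]) = op k (word_val op b w) b"
  by (simp_all add: word_val_def)

lemma word_val_in:
  assumes "As_algebra (m + 1) s V op" "b \<in> V" "w \<in> A_words m"
  shows "word_val op b w \<in> V"
  using assms(3)
proof (induction w rule: rev_induct)
  case (snoc k w)
  then show ?case
    using assms(1,2) bilinear_op_onD(3)[of s V "op k"] by (auto simp: As_algebra_def)
qed (simp add: assms)

text \<open>Mutual associativity moves the last factor b from the whole product into the right
  operand.\<close>

lemma word_val_append:
  assumes A: "As_algebra (m + 1) s V op" and b: "b \<in> V"
    and w: "w \<in> A_words m" and k: "k \<le> m" and w': "w' \<in> A_words m"
  shows "word_val op b (w @ [k] @ w') = op k (word_val op b w) (word_val op b w')"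
  using w'
proof (induction w' rule: rev_induct)
  case Nil
  then show ?case by (simp add: word_val_def)
next
  case (snoc j w')
  then have w': "w' \<in> A_words m" and j: "j \<le> m" by auto
  have "word_val op b (w @ [k] @ w' @ [j]) = op j (word_val op b (w @ [k] @ w')) b"
    using word_val_simps(2)[of op b "w @ [k] @ w'" j] by simp
  also have "\<dots> = op j (op k (word_val op b w) (word_val op b w')) b"
    using snoc.IH[OF w'] by simp
  also have "\<dots> = op k (word_val op b w) (op j (word_val op b w') b)"
    using A j k b word_val_in[OF A b w] word_val_in[OF A b w'] by (simp add: As_algebra_def)
  finally show ?case by simp
qed

context
  fixes m :: nat
  assumes m_pos: "m \<ge> 1"
begin

lemma ex_GD: "w \<in> A_words m \<Longrightarrow> \<exists>\<sigma>. \<sigma> \<in> m_perms m (length w + 1) \<and> GD (length w + 1) \<sigma> = w"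
proof (induction w rule: rev_induct)
  case Nil
  have "replicate m 1 \<in> m_perms m 1" by (auto simp: m_perms_def count_list_replicate)
  then show ?case by (auto simp: GD_def)
next
  case (snoc k w)
  define n where "n = length w + 1"
  from snoc obtain \<sigma> where \<sigma>: "\<sigma> \<in> m_perms m n" "GD n \<sigma> = w" and k: "k \<le> m"
    by (auto simp: n_def)
  \<comment> \<open>The k copies in front of \<sigma> lie to the left of the last n and the other m
    - k to its right, so k becomes the new entry; the order among the old letters is
    untouched.\<close>
  define \<tau> where "\<tau> = replicate k (n + 1) @ \<sigma> @ replicate (m - k) (n + 1)"
  have set: "set \<sigma> = {1..n}" by (rule set_m_perms[OF m_pos \<sigma>(1)])
  have "count_list \<tau> i = m" if "i \<in> {1..n + 1}" for i
  proof (cases "i = n + 1")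
    case True
    moreover have "count_list \<sigma> (n + 1) = 0" using set by (simp add: count_list_0_iff)
    ultimately show ?thesis using k by (simp add: \<tau>_def count_list_replicate)
  next
    case False
    then show ?thesis using \<sigma>(1) that by (simp add: \<tau>_def m_perms_def count_list_replicate)
  qed
  moreover have "set \<tau> \<subseteq> {1..n + 1}" using set by (auto simp: \<tau>_def)
  ultimately have \<tau>: "\<tau> \<in> m_perms m (n + 1)" by (simp add: m_perms_def)
  have "lo n \<tau> = \<sigma>" using set by (simp add: \<tau>_def lo_def filter_id_conv)
  then have "take (length w) (GD (n + 1) \<tau>) = w"
    using GD_lo[OF m_pos \<tau>, of n] \<sigma>(2) by (simp add: n_def)
  moreover have "GD (n + 1) \<tau> ! length w = k"
  proof -
    have "before_last \<sigma> n (n + 1) = 0" using set by (simp add: before_last_notin_right)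
    then have "before_last \<tau> n (n + 1) = k"
      using set by (simp add: \<tau>_def before_last_append n_def count_list_replicate)
    then show ?thesis using GD_nth[OF m_pos \<tau>, of "length w"] by (simp add: n_def)
  qed
  moreover have "length (GD (n + 1) \<tau>) = length w + 1" by (simp add: n_def length_GD[OF m_pos])
  ultimately have "GD (n + 1) \<tau> = w @ [k]"
    by (metis Suc_eq_plus1 lessI take_Suc_conv_app_nth take_all order_refl)
  then show ?case using \<tau> by (auto simp: n_def)
qed

lemma gd_witness:
  "w \<in> A_words m \<Longrightarrow> gd_witness m w \<in> m_perms m (length w + 1)"
  "w \<in> A_words m \<Longrightarrow> GD (length w + 1) (gd_witness m w) = w"
  using someI_ex[OF ex_GD] unfolding gd_witness_def by blast+

text \<open>All members of the class have coefficient 1 in \<open>R m w\<close>, and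
  \<open>R_ext\<close> reads off exactly one of them, the witness.\<close>

lemma R_ext_R:
  assumes "vector_space s" and w: "w \<in> A_words m"
  shows "R_ext s m f (R m w) = f w"
proof -
  interpret V: vector_space s by fact
  let ?A = "{\<sigma>. \<sigma> \<in> m_perms m (length w + 1) \<and> GD (length w + 1) \<sigma> = w}"
  have fin: "finite ?A" by simp
  have "R_ext s m f (R m w) = (\<Sum>\<sigma>\<in>?A. if \<sigma> = gd_witness m (GD (length \<sigma> div m) \<sigma>)
      then f (GD (length \<sigma> div m) \<sigma>) else 0)"
    by (simp add: R_ext_def R_def V.lin_ext_sum F_def)
  also have "\<dots> = (\<Sum>\<sigma>\<in>?A. if \<sigma> = gd_witness m w then f w else 0)"
  proof (rule sum.cong[OF refl])
    fix \<sigma> assume "\<sigma> \<in> ?A"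
    then have "length \<sigma> div m = length w + 1" "GD (length w + 1) \<sigma> = w"
      using m_perms_degree[OF m_pos] by blast+
    then show "(if \<sigma> = gd_witness m (GD (length \<sigma> div m) \<sigma>) then f (GD (length \<sigma> div m) \<sigma>) else 0)
        = (if \<sigma> = gd_witness m w then f w else 0)" by (simp only:)
  qed
  also have "\<dots> = f w" using fin gd_witness[OF w] by simp
  finally show ?thesis .
qed

lemma R_ext_in:
  assumes "vector_space s" "module.subspace s V" "\<And>w. w \<in> A_words m \<Longrightarrow> f w \<in> V" "x \<in> FQSym m"
  shows "R_ext s m f x \<in> V"
proof -
  interpret V: vector_space s by fact
  show ?thesis
    unfolding R_ext_def
  proof (rule V.lin_ext_in_subspace[OF assms(2)])
    fix \<sigma> assume "\<sigma> \<in> Poly_Mapping.keys x"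
    then obtain n where \<sigma>: "\<sigma> \<in> m_perms m n" using assms(4) unfolding FQSym_def by blast
    then have "GD (length \<sigma> div m) \<sigma> \<in> A_words m"
      using m_perms_degree[OF m_pos \<sigma>] GD_in_A_words[OF m_pos \<sigma>] by simp
    then show "(if \<sigma> = gd_witness m (GD (length \<sigma> div m) \<sigma>)
        then f (GD (length \<sigma> div m) \<sigma>) else 0) \<in> V"
      using assms(3) V.subspace_0[OF assms(2)] by simp
  qed
qed

lemma counit_R: "fq_counit (R m w) = 0"
  by (simp add: fq_counit_def R_gd_sum lookup_gd_sum Nil_in_m_perms[OF m_pos])

lemma NCSF_plus_eq: "(NCSF_plus m :: 'k::field fq set) = fvs.span (R m ` A_words m)"
proof
  have sub: "fvs.subspace {x :: 'k fq. fq_counit x = 0}"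
    by (rule fvs.subspaceI) (auto simp: fq_counit_def lookup_add)
  then have counit: "fq_counit x = 0" if "x \<in> fvs.span (R m ` A_words m)" for x :: "'k fq"
    using fvs.span_minimal[of "R m ` A_words m" "{x :: 'k fq. fq_counit x = 0}"] that counit_R
    by blast
  have "fvs.span (R m ` A_words m) \<subseteq> (gd_invariant m :: 'k fq set)"
    by (rule fvs.span_minimal[OF _ subspace_gd_invariant])
      (auto intro: R_in_gd_invariant[OF m_pos])
  then show "fvs.span (R m ` A_words m) \<subseteq> (NCSF_plus m :: 'k fq set)"
    using counit by (auto simp: NCSF_plus_def NCSF_eq[OF m_pos])
  show "(NCSF_plus m :: 'k fq set) \<subseteq> fvs.span (R m ` A_words m)"
  proof
    fix x :: "'k fq" assume "x \<in> NCSF_plus m"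
    then have x: "x \<in> gd_invariant m" "fq_counit x = 0"
      by (auto simp: NCSF_plus_def NCSF_eq[OF m_pos])
    from gd_invariant_span[OF m_pos x(1)] obtain c
      where c: "x - fscale c fq_one \<in> fvs.span (R m ` A_words m)"
      unfolding fvs.span_breakdown_eq by blast
    \<comment> \<open>The counit vanishes on the span of the \<open>R m w\<close>, so it detects the
      coefficient of the unit.\<close>
    have "c = 0"
      using counit[OF c] x(2) by (simp add: fq_counit_def lookup_minus fq_one_def lookup_F)
    then show "x \<in> fvs.span (R m ` A_words m)" using c by simp
  qed
qed

lemma NCSF_plus_FQSym: "x \<in> NCSF_plus m \<Longrightarrow> x \<in> FQSym m"
  by (simp add: NCSF_plus_def NCSF_eq[OF m_pos] gd_invariant_FQSym)

lemma subspace_NCSF_plus: "fvs.subspace (NCSF_plus m :: 'k::field fq set)"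
  unfolding NCSF_plus_eq by (rule fvs.subspace_span)

lemma R_in_NCSF_plus: "w \<in> A_words m \<Longrightarrow> R m w \<in> (NCSF_plus m :: 'k::field fq set)"
  unfolding NCSF_plus_eq by (rule fvs.span_base) simp

text \<open>Applied once per argument, this reduces bilinear and trilinear identities to the
  elements \<open>R m w\<close>.\<close>

lemma NCSF_plus_linear_eq:
  fixes f g :: "'k::field fq \<Rightarrow> 'b::ab_group_add"
  assumes "linear_map_on fscale (NCSF_plus m) s' V' f" "linear_map_on fscale (NCSF_plus m) s' V'' g"
    and "\<And>w. w \<in> A_words m \<Longrightarrow> f (R m w) = g (R m w)" and "x \<in> NCSF_plus m"
  shows "f x = g x"
  using linear_map_on_span_eq[of "R m ` A_words m" s' V' f V'' g x] assms
  unfolding NCSF_plus_eq by blast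

lemma linear_map_on_R_ext:
  assumes "vector_space s" "module.subspace s V" "\<And>w. w \<in> A_words m \<Longrightarrow> f w \<in> V"
  shows "linear_map_on fscale (NCSF_plus m) s V (R_ext s m f)"
proof -
  interpret V: vector_space s by fact
  have "R_ext s m f x \<in> V" if "x \<in> NCSF_plus m" for x
    by (rule R_ext_in[OF assms(1,2)]) (use assms(3) NCSF_plus_FQSym[OF that] in auto)
  then show ?thesis
    by (simp add: linear_map_on_def V.R_ext_add V.R_ext_scale)
qed

lemma ex_R_operations: "\<exists>op :: nat \<Rightarrow> 'k::field fq \<Rightarrow> 'k fq \<Rightarrow> 'k fq. R_operations m op"
proof
  let ?r = "R_ext fscale m :: (nat list \<Rightarrow> 'k fq) \<Rightarrow> 'k fq \<Rightarrow> 'k fq"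
  \<comment> \<open>The bilinear extension of the rule on the \<open>R m w\<close>: in y for each
    fixed word w, then in x.\<close>
  let ?op = "\<lambda>k x y. ?r (\<lambda>w. ?r (\<lambda>w'. R m (w @ [k] @ w')) y) x"
  note vs = fvs.vector_space_axioms subspace_NCSF_plus[where 'k = 'k]
  have inner: "?r (\<lambda>w'. R m (w @ [k] @ w')) y \<in> NCSF_plus m"
    if "k \<le> m" "y \<in> NCSF_plus m" "w \<in> A_words m" for k y w
    by (rule R_ext_in[OF vs _ NCSF_plus_FQSym]) (use that in \<open>auto intro!: R_in_NCSF_plus\<close>)
  show "R_operations m ?op"
    unfolding R_operations_def
  proof (intro allI impI conjI ballI)
    fix k assume k: "k \<le> m"
    show "bilinear_op_on fscale (NCSF_plus m) (?op k)"
      unfolding bilinear_op_on_def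
    proof (intro conjI ballI)
      fix x :: "'k fq" assume x: "x \<in> NCSF_plus m"
      have "?op k x y \<in> NCSF_plus m" if "y \<in> NCSF_plus m" for y
        by (rule R_ext_in[OF vs _ NCSF_plus_FQSym]) (use k x that inner in auto)
      then show "linear_map_on fscale (NCSF_plus m) fscale (NCSF_plus m) (?op k x)"
        by (simp add: linear_map_on_def fvs.R_ext_add fvs.R_ext_scale fvs.R_ext_fun_add
            fvs.R_ext_fun_scale)
    next
      fix y :: "'k fq" assume y: "y \<in> NCSF_plus m"
      show "linear_map_on fscale (NCSF_plus m) fscale (NCSF_plus m) (\<lambda>x. ?op k x y)"
        by (rule linear_map_on_R_ext[OF vs]) (rule inner[OF k y])
    qed
    show "?op k (R m w) (R m w') = R m (w @ [k] @ w')"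
      if "w \<in> A_words m" "w' \<in> A_words m" for w w'
      using that by (simp only: R_ext_R[OF fvs.vector_space_axioms])
  qed
qed

text \<open>By trilinearity it suffices to evaluate at \<open>R m w\<close>, \<open>R m w'\<close>
  and \<open>R m w''\<close>, where both bracketings give \<open>R\<close> of the same word w i w' j
  w''.\<close>

lemma As_algebra_NCSF_plus:
  fixes op :: "nat \<Rightarrow> 'k::field fq \<Rightarrow> 'k fq \<Rightarrow> 'k fq"
  assumes op: "R_operations m op"
  shows "As_algebra (m + 1) fscale (NCSF_plus m) op"
proof -
  let ?V = "NCSF_plus m :: 'k fq set"
  have bil: "bilinear_op_on fscale ?V (op k)" if "k \<le> m" for k
    using op that by (simp add: R_operations_def)
  have R: "op k (R m w) (R m w') = R m (w @ [k] @ w')"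
    if "k \<le> m" "w \<in> A_words m" "w' \<in> A_words m" for k w w'
    using op that by (simp add: R_operations_def)
  note L = bilinear_op_onD(1)[OF bil] and Rt = bilinear_op_onD(2)[OF bil]
    and cl = bilinear_op_onD(3)[OF bil]
  have "op j (op i x y) z = op i x (op j y z)"
    if i: "i \<le> m" and j: "j \<le> m" and x: "x \<in> ?V" and y: "y \<in> ?V" and z: "z \<in> ?V" for i j x y z
  proof (rule NCSF_plus_linear_eq[OF _ _ _ x, where f = "\<lambda>x. op j (op i x y) z"])
    show "linear_map_on fscale ?V fscale ?V (\<lambda>x. op j (op i x y) z)"
      by (rule linear_map_on_comp[OF Rt[OF i y] Rt[OF j z]])
    show "linear_map_on fscale ?V fscale ?V (\<lambda>x. op i x (op j y z))"
      by (rule Rt[OF i cl[OF j y z]])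
    fix w assume w: "w \<in> A_words m"
    note Rw = R_in_NCSF_plus[OF w, where 'k = 'k]
    show "op j (op i (R m w) y) z = op i (R m w) (op j y z)"
    proof (rule NCSF_plus_linear_eq[OF _ _ _ y, where f = "\<lambda>y. op j (op i (R m w) y) z"])
      show "linear_map_on fscale ?V fscale ?V (\<lambda>y. op j (op i (R m w) y) z)"
        by (rule linear_map_on_comp[OF L[OF i Rw] Rt[OF j z]])
      show "linear_map_on fscale ?V fscale ?V (\<lambda>y. op i (R m w) (op j y z))"
        by (rule linear_map_on_comp[OF Rt[OF j z] L[OF i Rw]])
      fix w' assume w': "w' \<in> A_words m"
      note Rw' = R_in_NCSF_plus[OF w', where 'k = 'k]
      show "op j (op i (R m w) (R m w')) z = op i (R m w) (op j (R m w') z)"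
      proof (rule NCSF_plus_linear_eq[OF _ _ _ z, where f = "op j (op i (R m w) (R m w'))"])
        show "linear_map_on fscale ?V fscale ?V (op j (op i (R m w) (R m w')))"
          by (rule L[OF j cl[OF i Rw Rw']])
        show "linear_map_on fscale ?V fscale ?V (\<lambda>z. op i (R m w) (op j (R m w') z))"
          by (rule linear_map_on_comp[OF L[OF j Rw'] L[OF i Rw]])
        fix w'' assume "w'' \<in> A_words m"
        then show "op j (op i (R m w) (R m w')) (R m w'') = op i (R m w) (op j (R m w') (R m w''))"
          using i j w w' by (simp add: R)
      qed
    qed
  qed
  then show ?thesis
    using bil subspace_NCSF_plus fvs.vector_space_axioms
    by (simp add: As_algebra_def less_Suc_eq_le)
qed

lemma free_As_algebra_NCSF_plus:
  fixes op :: "nat \<Rightarrow> 'k::field fq \<Rightarrow> 'k fq \<Rightarrow> 'k fq"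
  assumes op: "R_operations m op"
  shows "free_As_algebra TYPE('w::ab_group_add) (m + 1) fscale (NCSF_plus m) op (R m [])"
  unfolding free_As_algebra_def
proof (intro conjI allI impI)
  let ?V = "NCSF_plus m :: 'k fq set"
  show As: "As_algebra (m + 1) fscale ?V op" by (rule As_algebra_NCSF_plus[OF op])
  show "R m [] \<in> ?V" by (rule R_in_NCSF_plus) simp
  have bil: "bilinear_op_on fscale ?V (op k)" if "k \<le> m" for k
    using op that by (simp add: R_operations_def)
  have R: "op k (R m w) (R m w') = R m (w @ [k] @ w')"
    if "k \<le> m" "w \<in> A_words m" "w' \<in> A_words m" for k w w'
    using op that by (simp add: R_operations_def)
  note L = bilinear_op_onD(1)[OF bil] and Rt = bilinear_op_onD(2)[OF bil]
    and cl = bilinear_op_onD(3)[OF bil]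
  fix s' :: "'k \<Rightarrow> 'w \<Rightarrow> 'w" and V' op' b
  assume "As_algebra (m + 1) s' V' op' \<and> b \<in> V'"
  then have A: "As_algebra (m + 1) s' V' op'" and b: "b \<in> V'" by auto
  then have vs: "vector_space s'" "module.subspace s' V'"
    and bil': "\<And>k. k \<le> m \<Longrightarrow> bilinear_op_on s' V' (op' k)"
    by (auto simp: As_algebra_def)
  note L' = bilinear_op_onD(1)[OF bil'] and Rt' = bilinear_op_onD(2)[OF bil']
  let ?e = "R_ext s' m (word_val op' b)"
  \<comment> \<open>Restricted because uniqueness in the universal property is meant among
    extensional functions.\<close>
  define \<phi> where "\<phi> = restrict ?e ?V"
  have e: "linear_map_on fscale ?V s' V' ?e"
    by (rule linear_map_on_R_ext[OF vs]) (rule word_val_in[OF A b])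
  then have \<phi>: "linear_map_on fscale ?V s' V' \<phi>"
    using subspace_NCSF_plus[where 'k = 'k]
    unfolding linear_map_on_def \<phi>_def by (auto simp: fvs.subspace_add fvs.subspace_scale)
  then have \<phi>_in: "\<phi> x \<in> V'" if "x \<in> ?V" for x using that by (auto simp: linear_map_on_def)
  have \<phi>_R: "\<phi> (R m w) = word_val op' b w" if "w \<in> A_words m" for w
    using that by (simp add: \<phi>_def R_in_NCSF_plus R_ext_R[OF vs(1)])
  have hom: "\<phi> (op i x y) = op' i (\<phi> x) (\<phi> y)"
    if i: "i \<le> m" and x: "x \<in> ?V" and y: "y \<in> ?V" for i x y
  proof (rule NCSF_plus_linear_eq[OF _ _ _ x, where f = "\<lambda>x. \<phi> (op i x y)"])
    show "linear_map_on fscale ?V s' V' (\<lambda>x. \<phi> (op i x y))"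
      by (rule linear_map_on_comp[OF Rt[OF i y] \<phi>])
    show "linear_map_on fscale ?V s' V' (\<lambda>x. op' i (\<phi> x) (\<phi> y))"
      by (rule linear_map_on_comp[OF \<phi> Rt'[OF i \<phi>_in[OF y]]])
    fix w assume w: "w \<in> A_words m"
    note Rw = R_in_NCSF_plus[OF w, where 'k = 'k]
    show "\<phi> (op i (R m w) y) = op' i (\<phi> (R m w)) (\<phi> y)"
    proof (rule NCSF_plus_linear_eq[OF _ _ _ y, where f = "\<lambda>y. \<phi> (op i (R m w) y)"])
      show "linear_map_on fscale ?V s' V' (\<lambda>y. \<phi> (op i (R m w) y))"
        by (rule linear_map_on_comp[OF L[OF i Rw] \<phi>])
      show "linear_map_on fscale ?V s' V' (\<lambda>y. op' i (\<phi> (R m w)) (\<phi> y))"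
        by (rule linear_map_on_comp[OF \<phi> L'[OF i \<phi>_in[OF Rw]]])
      fix w' assume w': "w' \<in> A_words m"
      have "w @ [i] @ w' \<in> A_words m" using i w w' by simp
      then show "\<phi> (op i (R m w) (R m w')) = op' i (\<phi> (R m w)) (\<phi> (R m w'))"
        using word_val_append[OF A b w i w'] i w w' by (simp only: R \<phi>_R)
    qed
  qed
  show "\<exists>!\<phi>. \<phi> \<in> extensional ?V \<and> As_hom (m + 1) fscale ?V op s' V' op' \<phi> \<and> \<phi> (R m []) = b"
  proof (rule ex1I[of _ \<phi>])
    show "\<phi> \<in> extensional ?V \<and> As_hom (m + 1) fscale ?V op s' V' op' \<phi> \<and> \<phi> (R m []) = b"
      using \<phi> hom \<phi>_R[of "[]"] by (simp add: As_hom_def \<phi>_def)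
    fix \<psi> assume \<psi>: "\<psi> \<in> extensional ?V \<and> As_hom (m + 1) fscale ?V op s' V' op' \<psi> \<and> \<psi> (R m []) = b"
    then have lin: "linear_map_on fscale ?V s' V' \<psi>"
      and \<psi>_op: "\<psi> (op i x y) = op' i (\<psi> x) (\<psi> y)" if "i \<le> m" "x \<in> ?V" "y \<in> ?V" for i x y
      using that by (auto simp: As_hom_def)
    have \<psi>_R: "\<psi> (R m w) = word_val op' b w" if "w \<in> A_words m" for w
      using that
    proof (induction w rule: rev_induct)
      case Nil
      then show ?case using \<psi> by simp
    next
      case (snoc k w)
      then have w: "w \<in> A_words m" "k \<le> m" by auto
      \<comment> \<open>Splitting off the generator on the right expresses every
        \<open>R m w\<close> through \<open>R m []\<close>, so a homomorphism is determined by its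
        value there.\<close>
      have "R m (w @ [k]) = op k (R m w) (R m [] :: 'k fq)" using w by (simp add: R)
      then show ?case
        using \<psi> w snoc.IH \<psi>_op[OF w(2) R_in_NCSF_plus R_in_NCSF_plus, of w "[]"] by simp
    qed
    show "\<psi> = \<phi>"
    proof (rule extensionalityI)
      show "\<psi> \<in> extensional ?V" "\<phi> \<in> extensional ?V" using \<psi> by (auto simp: \<phi>_def)
      fix x assume x: "x \<in> ?V"
      show "\<psi> x = \<phi> x"
        by (rule NCSF_plus_linear_eq[OF _ \<phi> _ x])
          (use \<psi> in \<open>auto simp: As_hom_def \<psi>_R \<phi>_R\<close>)
    qed
  qed
qed

end

text \<open>The operations are prescribed only on the augmentation ideal and are not unique as
  functions on the whole type. Existence is therefore stated apart from the properties, which hold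
  for every choice.\<close>

theorem theorem4p9:
  fixes m :: nat
  assumes "m \<ge> 1"
  shows "hopf_subalgebra m (NCSF m :: 'k::field_char_0 fq set) \<and>
    (\<forall>w\<in>A_words m. \<forall>w'\<in>A_words m.
       fq_mult m (R m w) (R m w' :: 'k fq) = (\<Sum>k\<in>{0..m}. R m (w @ [k] @ w'))) \<and>
    (\<exists>op :: nat \<Rightarrow> 'k fq \<Rightarrow> 'k fq \<Rightarrow> 'k fq. R_operations m op) \<and>
    (\<forall>op :: nat \<Rightarrow> 'k fq \<Rightarrow> 'k fq \<Rightarrow> 'k fq. R_operations m op \<longrightarrow>
       As_algebra (m + 1) fscale (NCSF_plus m) op \<and>
       free_As_algebra TYPE('w::ab_group_add) (m + 1) fscale (NCSF_plus m) op (R m []))"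
  using hopf_subalgebra_NCSF[OF assms] R_product[OF assms] ex_R_operations[OF assms]
    As_algebra_NCSF_plus[OF assms] free_As_algebra_NCSF_plus[OF assms]
  by blast

end
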